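(* Fix $\alpha\in(0,1)$ and let $\log d=o(n^{1/3})$ as $n$ grows. Each of the four tests $T_\alpha^\rho,T_\alpha^\tau,T_\alpha^{\widehat\rho},T_\alpha^{\widehat\tau}$ is rate-optimal against the corresponding sparse alternative. That is, for each $\ell\in\{\rho,\tau,\widehat\rho,\widehat\tau\}$ there exist two constants $D_1<D_2$ such that $$\sup_{F(X)\in H_a^\ell(D_2)}\mathrm{pr}(T_\alpha^\ell=0)=o(1),$$ and for any $\beta>0$ satisfying $\alpha+\beta<1$, for large $n$ and $d$, $$\inf_{T_\alpha\in\mathcal T_\alpha}\sup_{F(X)\in H_a^\ell(D_1)}\mathrm{pr}(T_\alpha=0)\ge1-\alpha-\beta.$$
   Context: Setting: $X=(X_1,\ldots,X_d)^{\mathrm T}$ is a continuous random vector in $\mathbb{R}^d$ with joint distribution function $F(X)$, and $X_{1,\cdot},\ldots,X_{n,\cdot}$, $X_{i,\cdot}=(X_{i,1},\ldots,X_{i,d})^{\mathrm T}$, are $n$ independent copies of $X$. The dimension $d=d_n$ may depend on $n$; both $n$ and $d$ tend to infinity. $H_0$: $X_1,\ldots,X_d$ are mutually independent. $\mathcal T_\alpha$ is the set of all measurable tests $T_\alpha$ based on the $n$ observations with $\mathrm{pr}(T_\alpha=1\mid H_0)\le\alpha$. Relative ranks: $Q_{ni}^j$ is the rank of $X_{i,j}$ in $\{X_{1,j},\ldots,X_{n,j}\}$, and $R_{ni}^{jk}=Q_{ni'}^k$ where $i'$ is the index with $Q_{ni'}^j=i$. With $\mathrm{sign}(x)=x/|x|$,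 $\mathrm{sign}(0)=0$, for $j\ne k$: $\rho_{jk}=\frac{12}{n(n^2-1)}\sum_{i=1}^n\big(i-\frac{n+1}2\big)\big(R_{ni}^{jk}-\frac{n+1}2\big)$ (Spearman's rho); $\tau_{jk}=\frac{2}{n(n-1)}\sum_{i<i'}\mathrm{sign}(X_{i',j}-X_{i,j})\mathrm{sign}(X_{i',k}-X_{i,k})$ (Kendall's tau); $\widehat\rho_{jk}=\frac{3}{n(n-1)(n-2)}\sum_{i\ne i'\ne i''}\mathrm{sign}(X_{i,j}-X_{i',j})\mathrm{sign}(X_{i,k}-X_{i'',k})$ (sum over pairwise distinct indices); $\widehat\tau_{jk}=\frac{8}{n^2(n-1)}\sum_{i=1}^n\big(i-\frac{n+1}2\big)\big(R_{ni}^{jk}-\frac{n+1}2\big)$. All four have mean zero under $H_0$, with null variances $\mathrm{var}_{H_0}(\rho_{jk})=\frac1{n-1}$, $\mathrm{var}_{H_0}(\tau_{jk})=\frac{2(2n+5)}{9n(n-1)}$, $\mathrm{var}_{H_0}(\widehat\rho_{jk})=\frac{n^2-3}{n(n-1)(n-2)}$, $\mathrm{var}_{H_0}(\widehat\tau_{jk})=\frac{4(n+1)^2}{9n^2(n-1)}$. Writing $\ell_{jk}$ for the statistic of type $\ell$, the tests are $$T_\alpha^\ell=I\Big\{\frac{\max_{j<k}\ell_{jk}^2}{\mathrm{var}_{H_0}(\ell_{12})}-4\log d+\log\log d\ge q_\alpha\Big\},\qquad q_\alpha=-\log(8\pi)-2\log\log(1-\alpha)^{-1}.$$ Sparse alternatives: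 for a constant $c$, $$\mathcal U(c)=\Big\{M\in\mathbb{R}^{d\times d}:\mathrm{diag}(M)=I_d,\ M=M^{\mathrm T},\ \max_{j<k}|M_{jk}|\ge c(\log d/n)^{1/2}\Big\}.$$ Let $M^\ell=M^\ell\{F(X)\}$ be the symmetric matrix with unit diagonal and off-diagonal entries $M^\ell_{jk}=E(\ell_{jk})/s_\ell$ ($j<k$), expectation under $F(X)$, where for the simple linear rank statistics $\ell\in\{\rho,\widehat\tau\}$, $s_\ell^2=n\,\mathrm{var}_{H_0}(\ell_{12})$, and for the rank-type $U$-statistics $\ell\in\{\tau,\widehat\rho\}$, of degree $m=2$ and $m=3$ respectively, $s_\ell^2=m^2\mathrm{var}_{H_0}[E_{H_0}\{h(X_{1,\{1,2\}},\ldots,X_{m,\{1,2\}})\mid X_{1,\{1,2\}}\}]$ with kernels $h(x_1,x_2)=\mathrm{sign}(x_{1,1}-x_{2,1})\mathrm{sign}(x_{1,2}-x_{2,2})$ for $\tau$ and $h(x_1,x_2,x_3)=3\,\mathrm{sign}(x_{1,1}-x_{2,1})\mathrm{sign}(x_{1,2}-x_{3,2})$ for $\widehat\rho$ (here $X_{i,\{1,2\}}=(X_{i,1},X_{i,2})$). Then $H_a^\ell(c)=\{F(X):M^\ell\{F(X)\}\in\mathcal U(c)\}$. *)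

theory Defs
  imports "HOL-Probability.Probability" "HOL-Library.Landau_Symbols"
begin

text \<open>
  A vector in \<open>\<real>\<^sup>d\<close> is a point of \<open>\<Pi>\<^sub>M j\<in>{1..d}. borel\<close>, and a sample of size \<open>n\<close> is a function \<open>x\<close>
  with \<open>x i j\<close> the \<open>j\<close>-th coordinate of the \<open>i\<close>-th observation (\<open>1 \<le> i \<le> n\<close>, \<open>1 \<le> j \<le> d\<close>).
  A joint distribution \<open>F(X)\<close> is represented by the probability measure it determines.
\<close>

definition vec_borel :: "nat \<Rightarrow> (nat \<Rightarrow> real) measure" where
  "vec_borel d = (\<Pi>\<^sub>M j\<in>{1..d}. borel)"

text \<open>Continuity of a random vector is continuity of its distribution function; for the joint
  distribution function this amounts to continuity of all the marginal ones.\<close>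

definition continuous_laws :: "nat \<Rightarrow> (nat \<Rightarrow> real) measure set" where
  "continuous_laws d = {F. prob_space F \<and> sets F = sets (vec_borel d) \<and>
     (\<forall>j\<in>{1..d}. continuous_on UNIV (cdf (distr F borel (\<lambda>v. v j))))}"

definition null_laws :: "nat \<Rightarrow> (nat \<Rightarrow> real) measure set" where
  "null_laws d = {F \<in> continuous_laws d.
     prob_space.indep_vars F (\<lambda>_. borel) (\<lambda>j v. v j) {1..d}}"

definition sample_law :: "nat \<Rightarrow> (nat \<Rightarrow> real) measure \<Rightarrow> (nat \<Rightarrow> nat \<Rightarrow> real) measure" where
  "sample_law n F = (\<Pi>\<^sub>M i\<in>{1..n}. F)"

definition obs_rank :: "nat \<Rightarrow> (nat \<Rightarrow> nat \<Rightarrow> real) \<Rightarrow> nat \<Rightarrow> nat \<Rightarrow> nat" where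
  "obs_rank n x j i = card {i'\<in>{1..n}. x i' j \<le> x i j}"

text \<open>Under a continuous law there are almost surely no ties, so that the index below is
  almost surely well defined.\<close>

definition rel_rank :: "nat \<Rightarrow> (nat \<Rightarrow> nat \<Rightarrow> real) \<Rightarrow> nat \<Rightarrow> nat \<Rightarrow> nat \<Rightarrow> nat" where
  "rel_rank n x j k i = obs_rank n x k (THE i'. i' \<in> {1..n} \<and> obs_rank n x j i' = i)"

definition spearman_rho :: "nat \<Rightarrow> (nat \<Rightarrow> nat \<Rightarrow> real) \<Rightarrow> nat \<Rightarrow> nat \<Rightarrow> real" where
  "spearman_rho n x j k = 12 / (real n * (real n ^ 2 - 1)) *
     (\<Sum>i=1..n. (real i - (real n + 1) / 2) * (real (rel_rank n x j k i) - (real n + 1) / 2))"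

definition kendall_tau :: "nat \<Rightarrow> (nat \<Rightarrow> nat \<Rightarrow> real) \<Rightarrow> nat \<Rightarrow> nat \<Rightarrow> real" where
  "kendall_tau n x j k = 2 / (real n * (real n - 1)) *
     (\<Sum>(i, i')\<in>{(i, i'). 1 \<le> i \<and> i < i' \<and> i' \<le> n}.
        sgn (x i' j - x i j) * sgn (x i' k - x i k))"

definition rho_hat :: "nat \<Rightarrow> (nat \<Rightarrow> nat \<Rightarrow> real) \<Rightarrow> nat \<Rightarrow> nat \<Rightarrow> real" where
  "rho_hat n x j k = 3 / (real n * (real n - 1) * (real n - 2)) *
     (\<Sum>(i, i', i'')\<in>{(i, i', i''). {i, i', i''} \<subseteq> {1..n} \<and> i \<noteq> i' \<and> i \<noteq> i'' \<and> i' \<noteq> i''}.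
        sgn (x i j - x i' j) * sgn (x i k - x i'' k))"

definition tau_hat :: "nat \<Rightarrow> (nat \<Rightarrow> nat \<Rightarrow> real) \<Rightarrow> nat \<Rightarrow> nat \<Rightarrow> real" where
  "tau_hat n x j k = 8 / (real n ^ 2 * (real n - 1)) *
     (\<Sum>i=1..n. (real i - (real n + 1) / 2) * (real (rel_rank n x j k i) - (real n + 1) / 2))"

datatype stat_type = Rho | Tau | Rho_hat | Tau_hat

fun stat :: "stat_type \<Rightarrow> nat \<Rightarrow> (nat \<Rightarrow> nat \<Rightarrow> real) \<Rightarrow> nat \<Rightarrow> nat \<Rightarrow> real" where
  "stat Rho = spearman_rho"
| "stat Tau = kendall_tau"
| "stat Rho_hat = rho_hat"
| "stat Tau_hat = tau_hat"

text \<open>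
  All null quantities below depend only on ranks or on signs of differences within each coordinate,
  hence have the same value under every law with independent continuous coordinates. They are
  evaluated at one such law of \<open>(X\<^sub>1, X\<^sub>2)\<close>: independent coordinates, uniform on \<open>[0, 1]\<close>.
\<close>

definition null_pair_law :: "(nat \<Rightarrow> real) measure" where
  "null_pair_law = (\<Pi>\<^sub>M j\<in>{1..2}. uniform_measure lborel {0..1})"

definition null_var :: "stat_type \<Rightarrow> nat \<Rightarrow> real" where
  "null_var l n = prob_space.variance (sample_law n null_pair_law) (\<lambda>x. stat l n x 1 2)"

definition null_cond_exp_first ::
    "nat \<Rightarrow> ((nat \<Rightarrow> nat \<Rightarrow> real) \<Rightarrow> real) \<Rightarrow> (nat \<Rightarrow> nat \<Rightarrow> real) \<Rightarrow> real" where
  "null_cond_exp_first m h =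
     (let P = sample_law m null_pair_law
      in real_cond_exp P (vimage_algebra (space P) (\<lambda>x. x 1) null_pair_law) h)"

definition projection_scale :: "nat \<Rightarrow> ((nat \<Rightarrow> nat \<Rightarrow> real) \<Rightarrow> real) \<Rightarrow> real" where
  "projection_scale m h =
     real m ^ 2 * prob_space.variance (sample_law m null_pair_law) (null_cond_exp_first m h)"

definition tau_kernel :: "(nat \<Rightarrow> nat \<Rightarrow> real) \<Rightarrow> real" where
  "tau_kernel x = sgn (x 1 1 - x 2 1) * sgn (x 1 2 - x 2 2)"

definition rho_hat_kernel :: "(nat \<Rightarrow> nat \<Rightarrow> real) \<Rightarrow> real" where
  "rho_hat_kernel x = 3 * sgn (x 1 1 - x 2 1) * sgn (x 1 2 - x 3 2)"

fun scale_sq :: "stat_type \<Rightarrow> nat \<Rightarrow> real" where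
  "scale_sq Rho n = real n * null_var Rho n"
| "scale_sq Tau_hat n = real n * null_var Tau_hat n"
| "scale_sq Tau n = projection_scale 2 tau_kernel"
| "scale_sq Rho_hat n = projection_scale 3 rho_hat_kernel"

definition dep_matrix ::
    "stat_type \<Rightarrow> nat \<Rightarrow> (nat \<Rightarrow> real) measure \<Rightarrow> nat \<Rightarrow> nat \<Rightarrow> real" where
  "dep_matrix l n F j k =
     (if j = k then 1
      else (\<integral>x. stat l n x (min j k) (max j k) \<partial>sample_law n F) / sqrt (scale_sq l n))"

text \<open>A matrix in \<open>\<real>\<^sup>d\<^sup>\<times>\<^sup>d\<close> is a function of two indices, of which only the values on
  \<open>{1..d} \<times> {1..d}\<close> matter.\<close>

definition sparse_matrices :: "nat \<Rightarrow> nat \<Rightarrow> real \<Rightarrow> (nat \<Rightarrow> nat \<Rightarrow> real) set" where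
  "sparse_matrices n d c = {M. (\<forall>j\<in>{1..d}. M j j = 1) \<and>
     (\<forall>j\<in>{1..d}. \<forall>k\<in>{1..d}. M j k = M k j) \<and>
     Max {\<bar>M j k\<bar> | j k. 1 \<le> j \<and> j < k \<and> k \<le> d} \<ge> c * sqrt (ln (real d) / real n)}"

definition alternatives :: "stat_type \<Rightarrow> nat \<Rightarrow> nat \<Rightarrow> real \<Rightarrow> (nat \<Rightarrow> real) measure set" where
  "alternatives l n d c = {F \<in> continuous_laws d. dep_matrix l n F \<in> sparse_matrices n d c}"

definition crit_value :: "real \<Rightarrow> real" where
  "crit_value \<alpha> = - ln (8 * pi) - 2 * ln (ln (1 / (1 - \<alpha>)))"

definition rank_test ::
    "stat_type \<Rightarrow> real \<Rightarrow> nat \<Rightarrow> nat \<Rightarrow> (nat \<Rightarrow> nat \<Rightarrow> real) \<Rightarrow> nat" where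
  "rank_test l \<alpha> n d x = of_bool
     (Max {(stat l n x j k)\<^sup>2 | j k. 1 \<le> j \<and> j < k \<and> k \<le> d} / null_var l n
        - 4 * ln (real d) + ln (ln (real d)) \<ge> crit_value \<alpha>)"

definition level_tests :: "real \<Rightarrow> nat \<Rightarrow> nat \<Rightarrow> ((nat \<Rightarrow> nat \<Rightarrow> real) \<Rightarrow> nat) set" where
  "level_tests \<alpha> n d =
     {T \<in> (\<Pi>\<^sub>M i\<in>{1..n}. vec_borel d) \<rightarrow>\<^sub>M count_space {0, 1}.
       \<forall>F\<in>null_laws d. measure (sample_law n F) {x \<in> space (sample_law n F). T x = 1} \<le> \<alpha>}"

text \<open>Probabilities of error are taken in \<^typ>\<open>ennreal\<close>, where suprema and infima always exist and
  the supremum over an empty class is 0.\<close>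

definition type_II_error ::
    "nat \<Rightarrow> ((nat \<Rightarrow> nat \<Rightarrow> real) \<Rightarrow> nat) \<Rightarrow> (nat \<Rightarrow> real) measure \<Rightarrow> ennreal" where
  "type_II_error n T F = emeasure (sample_law n F) {x \<in> space (sample_law n F). T x = 0}"

end

theory Submission
  imports Defs
begin

text \<open>
  Write \<open>s\<^sub>i\<^sub>i\<^sub>'(j) = sgn (x\<^sub>i\<^sub>j - x\<^sub>i\<^sub>'\<^sub>j)\<close>. Outside the null event of ties, a centred rank is half a sum of
  signs, so all four statistics are linear combinations of the two sums
  \<open>A = \<Sum> s\<^sub>i\<^sub>i\<^sub>'(j) s\<^sub>i\<^sub>i\<^sub>'(k)\<close> and \<open>B = \<Sum> s\<^sub>i\<^sub>i\<^sub>'(j) s\<^sub>i\<^sub>i\<^sub>'\<^sub>'(k)\<close> (lemma \<open>stat_eq_sign_stat\<close>).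

  Power. Replacing one observation moves \<open>A\<close> by \<open>O(n)\<close> and \<open>B\<close> by \<open>O(n\<^sup>2)\<close>, hence each statistic by
  \<open>O(1/n)\<close>; the Efron--Stein bound for functions with bounded differences then gives variance
  \<open>O(1/n)\<close> under every continuous law. The test accepts only if every \<open>\<ell>\<^sub>j\<^sub>k\<close> is of order
  \<open>sqrt (ln d / n)\<close>, whereas under an alternative some \<open>\<ell>\<^sub>j\<^sub>k\<close> has a mean of at least a large multiple
  of that. By Chebyshev the error is \<open>O(1 / ln d)\<close>, uniformly over the alternatives
  (lemma \<open>type_II_error_rank_test_le\<close>).

  Lower bound. Let all coordinates be uniform and independent except for the pair \<open>(1, k)\<close>, which has the
  Farlie--Gumbel--Morgenstern copula density \<open>1 + \<theta> g(u) g(v)\<close> with \<open>g(u) = 2 u - 1\<close>. Under this law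
  the mean of each statistic at \<open>(1, k)\<close> is proportional to \<open>\<theta>\<close> (lemma \<open>fgm_stat_mean\<close>), so
  \<open>\<theta> = sqrt (ln d / n) / 2\<close> produces alternatives at the critical rate. The likelihood ratios for
  different \<open>k\<close> are uncorrelated under independence, because \<open>g\<close> has mean zero, and each has second
  moment \<open>(1 + \<theta>\<^sup>2/9)\<^sup>n \<le> d\<^sup>1\<^sup>/\<^sup>2\<close>. The chi-square distance of their uniform mixture over \<open>k = 2, \<dots>, d\<close>
  from the null law is therefore at most about \<open>d\<^sup>-\<^sup>1\<^sup>/\<^sup>2\<close>, and no test of level \<open>\<alpha>\<close> has much more power
  than \<open>\<alpha>\<close> against the mixture (lemma \<open>type_II_error_lower_bound\<close>).

  Normalisation. The power bound needs scales \<open>s\<^sub>\<ell>\<^sup>2\<close> that stay away from zero, the lower bound needs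
  positive scales that stay bounded (lemma \<open>scale_sq_bounds\<close>). A lower bound \<open>c/n\<close> for the null variances comes from the same copula
  family: by Cauchy--Schwarz (the Chapman--Robbins inequality) a statistic whose mean moves by
  order \<open>n\<^sup>-\<^sup>1\<^sup>/\<^sup>2\<close> while the chi-square distance stays bounded has variance of order at least \<open>1/n\<close>. For the
  two \<open>U\<close>-statistics the projection is nondegenerate because the kernel is correlated
  with \<open>g(X\<^sub>1\<^sub>1) g(X\<^sub>1\<^sub>2)\<close>.
\<close>

section \<open>Resampling one observation\<close>

lemma measurable_resample:
  assumes "i \<in> I"
  shows "(\<lambda>(x, v). x(i := v)) \<in> (\<Pi>\<^sub>M _\<in>I. M) \<Otimes>\<^sub>M M \<rightarrow>\<^sub>M (\<Pi>\<^sub>M _\<in>I. M)"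
  using measurable_add_dim[of i I "\<lambda>_. M"] assms by (simp add: insert_absorb)

lemma space_resample:
  assumes "i \<in> I" "x \<in> space (\<Pi>\<^sub>M _\<in>I. M)" "v \<in> space M"
  shows "x(i := v) \<in> space (\<Pi>\<^sub>M _\<in>I. M)"
  using assms by (auto simp: space_PiM PiE_def extensional_def Pi_def)

lemma borel_measurable_resample_integral:
  fixes f :: "('i \<Rightarrow> 'a) \<Rightarrow> real"
  assumes "i \<in> I" "prob_space M" and [measurable]: "f \<in> borel_measurable (\<Pi>\<^sub>M _\<in>I. M)"
  shows "(\<lambda>x. \<integral>v. f (x(i := v)) \<partial>M) \<in> borel_measurable (\<Pi>\<^sub>M _\<in>I. M)"
proof -
  interpret M: prob_space M by fact
  have "(\<lambda>p. f (case p of (x, v) \<Rightarrow> x(i := v))) \<in> borel_measurable ((\<Pi>\<^sub>M _\<in>I. M) \<Otimes>\<^sub>M M)"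
    by (rule measurable_compose[OF measurable_resample[OF assms(1)] assms(3)])
  then show ?thesis
    by (intro M.borel_measurable_lebesgue_integral) (simp add: case_prod_beta')
qed

lemma prob_space_sample: "prob_space M \<Longrightarrow> prob_space (\<Pi>\<^sub>M _\<in>I. M)"
  by (rule prob_space_PiM)

text \<open>Redrawing one observation independently does not change the law of a sample. Applied repeatedly,
  this integrates out the observations of a product of signs one at a time.\<close>

lemma integral_resample:
  fixes f :: "('i \<Rightarrow> 'a) \<Rightarrow> real"
  assumes "finite I" "i \<in> I" "prob_space M" and f[measurable]: "f \<in> borel_measurable (\<Pi>\<^sub>M _\<in>I. M)"
    and bound: "\<And>x. x \<in> space (\<Pi>\<^sub>M _\<in>I. M) \<Longrightarrow> \<bar>f x\<bar> \<le> B"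
  shows "(\<integral>x. f x \<partial>(\<Pi>\<^sub>M _\<in>I. M)) = (\<integral>x. (\<integral>v. f (x(i := v)) \<partial>M) \<partial>(\<Pi>\<^sub>M _\<in>I. M))"
proof -
  interpret M: prob_space M by fact
  interpret product_sigma_finite "\<lambda>_::'i. M"
    by (simp add: product_sigma_finite_def M.sigma_finite_measure_axioms)
  interpret P: prob_space "\<Pi>\<^sub>M _\<in>I. M" by (rule prob_space_sample) fact
  define J where "J = I - {i}"
  have I: "I = insert i J" "i \<notin> J" "finite J" using assms by (auto simp: J_def)
  define h where "h = (\<lambda>x. \<integral>v. f (x(i := v)) \<partial>M)"
  have h[measurable]: "h \<in> borel_measurable (\<Pi>\<^sub>M _\<in>I. M)"
    unfolding h_def by (rule borel_measurable_resample_integral) fact+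
  have fv: "integrable M (\<lambda>v. f (x(i := v)))" if "x \<in> space (\<Pi>\<^sub>M _\<in>I. M)" for x
  proof (rule M.integrable_const_bound[where B=B])
    show "AE v in M. norm (f (x(i := v))) \<le> B"
      using bound space_resample[OF assms(2) that] by (intro AE_I2) auto
    show "(\<lambda>v. f (x(i := v))) \<in> borel_measurable M"
      using measurable_compose[OF measurable_Pair1'[OF that] measurable_compose[OF measurable_resample[OF assms(2)] f]]
      by simp
  qed
  have hB: "\<bar>h x\<bar> \<le> B" if "x \<in> space (\<Pi>\<^sub>M _\<in>I. M)" for x
  proof -
    have "\<bar>h x\<bar> \<le> (\<integral>v. \<bar>f (x(i := v))\<bar> \<partial>M)"
      unfolding h_def by (rule integral_abs_bound)
    also have "\<dots> \<le> (\<integral>v. B \<partial>M)"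
      using fv[OF that] bound space_resample[OF assms(2) that]
      by (intro integral_mono) auto
    finally show ?thesis by (simp add: M.prob_space)
  qed
  have "integrable (\<Pi>\<^sub>M _\<in>I. M) f" "integrable (\<Pi>\<^sub>M _\<in>I. M) h"
    using bound hB by (auto intro!: P.integrable_const_bound[where B=B])
  then have int: "integrable (\<Pi>\<^sub>M _\<in>insert i J. M) f" "integrable (\<Pi>\<^sub>M _\<in>insert i J. M) h"
    by (simp_all add: I(1))
  have "(\<integral>x. h x \<partial>(\<Pi>\<^sub>M _\<in>I. M)) = (\<integral>x. (\<integral>u. h (x(i := u)) \<partial>M) \<partial>(\<Pi>\<^sub>M _\<in>J. M))"
    unfolding I(1) using I int by (subst product_integral_insert) auto
  also have "\<dots> = (\<integral>x. (\<integral>v. f (x(i := v)) \<partial>M) \<partial>(\<Pi>\<^sub>M _\<in>J. M))"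
    by (simp add: h_def M.prob_space)
  also have "\<dots> = (\<integral>x. f x \<partial>(\<Pi>\<^sub>M _\<in>I. M))"
    unfolding I(1) using I int by (subst product_integral_insert) auto
  finally show ?thesis by (simp add: h_def)
qed

text \<open>For any fixed point \<open>z\<close> the variance is at most the second moment of \<open>f - f z\<close>, which is bounded
  by \<open>c\<^sup>2\<close>.\<close>

lemma (in prob_space) second_moment_le_range:
  fixes f :: "'a \<Rightarrow> real"
  assumes [measurable]: "f \<in> borel_measurable M" and "\<And>x y. x \<in> space M \<Longrightarrow> y \<in> space M \<Longrightarrow> \<bar>f x - f y\<bar> \<le> c"
  shows "expectation (\<lambda>x. (f x)\<^sup>2) \<le> c\<^sup>2 + (expectation f)\<^sup>2"
proof -
  obtain z where z: "z \<in> space M" using not_empty by blast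
  have B: "\<bar>f x - f z\<bar> \<le> c" if "x \<in> space M" for x using assms(2)[OF that z] .
  have [simp]: "integrable M f"
    using B by (intro integrable_const_bound[where B="c + \<bar>f z\<bar>"] AE_I2) fastforce+
  have "(f x - f z)\<^sup>2 \<le> c\<^sup>2" if "x \<in> space M" for x
    using B[OF that] by (metis abs_ge_zero power2_abs power_mono)
  then have i: "integrable M (\<lambda>x. (f x - f z)\<^sup>2)" and le: "expectation (\<lambda>x. (f x - f z)\<^sup>2) \<le> c\<^sup>2"
    by (auto intro!: integrable_const_bound[where B="c\<^sup>2"] integral_le_const)
  have "integrable M (\<lambda>x. (f x - f z)\<^sup>2 + (2 * f z * f x - (f z)\<^sup>2))" 
    using i by (intro Bochner_Integration.integrable_add) auto
  then have i2: "integrable M (\<lambda>x. (f x)\<^sup>2)"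
    by (rule Bochner_Integration.integrable_cong[THEN iffD1, rotated -1]) (auto simp: power2_eq_square algebra_simps)
  have "expectation (\<lambda>x. (f x - f z)\<^sup>2) = expectation (\<lambda>x. (f x)\<^sup>2) - 2 * f z * expectation f + (f z)\<^sup>2"
    using i2 by (simp add: power2_diff prob_space algebra_simps)
  moreover have "0 \<le> (expectation f - f z)\<^sup>2" by simp
  ultimately show ?thesis using le by (simp add: power2_diff algebra_simps)
qed

text \<open>A crude form of the Efron--Stein inequality. Integrating out one observation keeps the bounded
  differences, and the conditional variance given the other observations is at most \<open>c\<^sup>2\<close>; so the
  variance grows by at most \<open>c\<^sup>2\<close> per observation.\<close>

lemma second_moment_bounded_differences:
  fixes f :: "('i \<Rightarrow> 'a) \<Rightarrow> real"
  assumes "finite I" "prob_space M" "f \<in> borel_measurable (\<Pi>\<^sub>M _\<in>I. M)"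
    and "\<And>x. x \<in> space (\<Pi>\<^sub>M _\<in>I. M) \<Longrightarrow> \<bar>f x\<bar> \<le> B"
    and "\<And>x i v. x \<in> space (\<Pi>\<^sub>M _\<in>I. M) \<Longrightarrow> i \<in> I \<Longrightarrow> v \<in> space M \<Longrightarrow> \<bar>f (x(i := v)) - f x\<bar> \<le> c"
  shows "(\<integral>x. (f x)\<^sup>2 \<partial>(\<Pi>\<^sub>M _\<in>I. M)) \<le> real (card I) * c\<^sup>2 + (\<integral>x. f x \<partial>(\<Pi>\<^sub>M _\<in>I. M))\<^sup>2"
  using assms
proof (induction I arbitrary: f rule: finite_induct)
  case empty
  interpret prob_space "\<Pi>\<^sub>M _\<in>({}::'i set). M" using empty by (intro prob_space_sample)
  show ?case using second_moment_le_range[of f 0] empty by (simp add: space_PiM)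
next
  case (insert i I)
  interpret M: prob_space M by fact
  interpret product_sigma_finite "\<lambda>_::'i. M"
    by (simp add: product_sigma_finite_def M.sigma_finite_measure_axioms)
  interpret P: prob_space "\<Pi>\<^sub>M _\<in>I. M" by (rule prob_space_sample) fact
  interpret Q: prob_space "\<Pi>\<^sub>M _\<in>insert i I. M" by (rule prob_space_sample) fact
  note f[measurable] = insert.prems(2) and B = insert.prems(3) and c = insert.prems(4)
  define g where "g = (\<lambda>x. \<integral>v. f (x(i := v)) \<partial>M)"
  have upd: "x(i := v) \<in> space (\<Pi>\<^sub>M _\<in>insert i I. M)" if "x \<in> space (\<Pi>\<^sub>M _\<in>I. M)" "v \<in> space M" for x v
    using that by (auto simp: space_PiM PiE_def extensional_def Pi_def)
  have fm: "(\<lambda>v. f (x(i := v))) \<in> borel_measurable M" if "x \<in> space (\<Pi>\<^sub>M _\<in>I. M)" for x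
    using measurable_comp[OF measurable_component_update[OF that \<open>i \<notin> I\<close>] f] by (simp only: comp_def)
  have fi: "integrable M (\<lambda>v. f (x(i := v)))" if "x \<in> space (\<Pi>\<^sub>M _\<in>I. M)" for x
    using fm[OF that] B upd[OF that] by (intro M.integrable_const_bound[where B=B] AE_I2) auto
  have gB: "\<bar>g x\<bar> \<le> B" if "x \<in> space (\<Pi>\<^sub>M _\<in>I. M)" for x
  proof -
    have "\<bar>g x\<bar> \<le> (\<integral>v. \<bar>f (x(i := v))\<bar> \<partial>M)"
      unfolding g_def by (rule integral_abs_bound)
    also have "\<dots> \<le> B"
      using fi[OF that] B upd[OF that] by (intro M.integral_le_const AE_I2) auto
    finally show ?thesis .
  qed
  have gm[measurable]: "g \<in> borel_measurable (\<Pi>\<^sub>M _\<in>I. M)"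
    unfolding g_def by (intro M.borel_measurable_lebesgue_integral) measurable
  have hm: "(\<lambda>x. \<integral>v. (f (x(i := v)))\<^sup>2 \<partial>M) \<in> borel_measurable (\<Pi>\<^sub>M _\<in>I. M)"
    by (intro M.borel_measurable_lebesgue_integral) measurable
  have B2: "(f x)\<^sup>2 \<le> B\<^sup>2" if "x \<in> space (\<Pi>\<^sub>M _\<in>insert i I. M)" for x
    using B[OF that] by (metis abs_ge_zero power2_abs power_mono)
  have hB: "\<bar>\<integral>v. (f (x(i := v)))\<^sup>2 \<partial>M\<bar> \<le> B\<^sup>2" if "x \<in> space (\<Pi>\<^sub>M _\<in>I. M)" for x
  proof -
    have "integrable M (\<lambda>v. (f (x(i := v)))\<^sup>2)"
      using fm[OF that] B2 upd[OF that] by (intro M.integrable_const_bound[where B="B\<^sup>2"] AE_I2) auto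
    then have "(\<integral>v. (f (x(i := v)))\<^sup>2 \<partial>M) \<le> B\<^sup>2"
      using B2 upd[OF that] by (intro M.integral_le_const AE_I2) auto
    then show ?thesis by (simp add: integral_nonneg_AE)
  qed
  have g2: "(g x)\<^sup>2 \<le> B\<^sup>2" if "x \<in> space (\<Pi>\<^sub>M _\<in>I. M)" for x
    using gB[OF that] by (metis abs_ge_zero power2_abs power_mono)
  have gi: "integrable (\<Pi>\<^sub>M _\<in>I. M) (\<lambda>x. (g x)\<^sup>2)"
    using g2 by (intro P.integrable_const_bound[where B="B\<^sup>2"] AE_I2) auto
  have "(\<integral>x. (f x)\<^sup>2 \<partial>(\<Pi>\<^sub>M _\<in>insert i I. M)) = (\<integral>x. (\<integral>v. (f (x(i := v)))\<^sup>2 \<partial>M) \<partial>(\<Pi>\<^sub>M _\<in>I. M))"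
    using insert.hyps B2
    by (intro product_integral_insert Q.integrable_const_bound[where B="B\<^sup>2"] AE_I2) auto
  also have "\<dots> \<le> (\<integral>x. c\<^sup>2 + (g x)\<^sup>2 \<partial>(\<Pi>\<^sub>M _\<in>I. M))"
  proof (rule integral_mono)
    show "integrable (\<Pi>\<^sub>M _\<in>I. M) (\<lambda>x. \<integral>v. (f (x(i := v)))\<^sup>2 \<partial>M)"
      using hB hm by (intro P.integrable_const_bound[where B="B\<^sup>2"] AE_I2) auto
    show "(\<integral>v. (f (x(i := v)))\<^sup>2 \<partial>M) \<le> c\<^sup>2 + (g x)\<^sup>2" if "x \<in> space (\<Pi>\<^sub>M _\<in>I. M)" for x
      unfolding g_def
    proof (rule M.second_moment_le_range[OF fm[OF that]])
      fix u v assume "u \<in> space M" "v \<in> space M"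
      then show "\<bar>f (x(i := u)) - f (x(i := v))\<bar> \<le> c"
        using c[OF upd[OF that], of v i u] by (simp only: fun_upd_upd insertI1 simp_thms)
    qed
  qed (use gi in simp)
  also have "\<dots> = c\<^sup>2 + (\<integral>x. (g x)\<^sup>2 \<partial>(\<Pi>\<^sub>M _\<in>I. M))"
    using gi by (simp add: P.prob_space)
  also have "(\<integral>x. (g x)\<^sup>2 \<partial>(\<Pi>\<^sub>M _\<in>I. M)) \<le> real (card I) * c\<^sup>2 + (\<integral>x. g x \<partial>(\<Pi>\<^sub>M _\<in>I. M))\<^sup>2"
  proof (rule insert.IH[OF \<open>prob_space M\<close> gm gB])
    fix x j v assume x: "x \<in> space (\<Pi>\<^sub>M _\<in>I. M)" and j: "j \<in> I" and v: "v \<in> space M"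
    have x': "x(j := v) \<in> space (\<Pi>\<^sub>M _\<in>I. M)" by (rule space_resample) fact+
    have "\<bar>g (x(j := v)) - g x\<bar> = \<bar>\<integral>u. f (x(j := v, i := u)) - f (x(i := u)) \<partial>M\<bar>"
      unfolding g_def using fi[OF x] fi[OF x'] by simp
    also have "\<dots> \<le> (\<integral>u. \<bar>f (x(j := v, i := u)) - f (x(i := u))\<bar> \<partial>M)"
      by (rule integral_abs_bound)
    also have "\<dots> \<le> c"
    proof (rule M.integral_le_const)
      show "integrable M (\<lambda>u. \<bar>f (x(j := v, i := u)) - f (x(i := u))\<bar>)"
        using fi[OF x] fi[OF x'] by auto
      have "j \<noteq> i" using j insert.hyps by auto
      then show "AE u in M. \<bar>f (x(j := v, i := u)) - f (x(i := u))\<bar> \<le> c"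
        using c[OF upd[OF x], of _ j v] j v by (intro AE_I2) (metis fun_upd_twist insertI2)
    qed
    finally show "\<bar>g (x(j := v)) - g x\<bar> \<le> c" .
  qed
  also have "(\<integral>x. g x \<partial>(\<Pi>\<^sub>M _\<in>I. M)) = (\<integral>x. f x \<partial>(\<Pi>\<^sub>M _\<in>insert i I. M))"
    unfolding g_def using insert.hyps B
    by (intro product_integral_insert[symmetric] Q.integrable_const_bound[where B=B] AE_I2) auto
  finally show ?case using insert.hyps by (simp add: algebra_simps)
qed

section \<open>Rank statistics as sums of signs\<close>

definition sign_pairs :: "nat \<Rightarrow> (nat \<Rightarrow> nat \<Rightarrow> real) \<Rightarrow> nat \<Rightarrow> nat \<Rightarrow> real" where
  "sign_pairs n x j k = (\<Sum>i\<in>{1..n}. \<Sum>i'\<in>{1..n}. sgn (x i j - x i' j) * sgn (x i k - x i' k))"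

definition sign_triples :: "nat \<Rightarrow> (nat \<Rightarrow> nat \<Rightarrow> real) \<Rightarrow> nat \<Rightarrow> nat \<Rightarrow> real" where
  "sign_triples n x j k =
     (\<Sum>i\<in>{1..n}. \<Sum>i'\<in>{1..n}. \<Sum>i''\<in>{1..n}. sgn (x i j - x i' j) * sgn (x i k - x i'' k))"

text \<open>The representation of the four statistics by sums of signs. For the two statistics built from
  relative ranks it may differ on samples with ties; its differences are bounded everywhere.\<close>

fun sign_stat :: "stat_type \<Rightarrow> nat \<Rightarrow> (nat \<Rightarrow> nat \<Rightarrow> real) \<Rightarrow> nat \<Rightarrow> nat \<Rightarrow> real" where
  "sign_stat Rho n x j k = 3 * sign_triples n x j k / (real n * (real n ^ 2 - 1))"
| "sign_stat Tau n x j k = sign_pairs n x j k / (real n * (real n - 1))"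
| "sign_stat Rho_hat n x j k =
     3 * (sign_triples n x j k - sign_pairs n x j k) / (real n * (real n - 1) * (real n - 2))"
| "sign_stat Tau_hat n x j k = 2 * sign_triples n x j k / (real n ^ 2 * (real n - 1))"

text \<open>The sum of signs counts the observations below \<open>x i j\<close> minus those above it; with rank \<open>r\<close> and no
  ties this is \<open>(r - 1) - (n - r)\<close>.\<close>

lemma centred_rank_eq_sum_sgn:
  assumes "inj_on (\<lambda>i. x i j) {1..n}" "i \<in> {1..n}"
  shows "real (obs_rank n x j i) - (real n + 1) / 2 = (\<Sum>i'\<in>{1..n}. sgn (x i j - x i' j)) / 2"
proof -
  have "(\<Sum>i'\<in>{1..n}. sgn (x i j - x i' j)) =
      (\<Sum>i'\<in>{1..n}. 2 * of_bool (x i' j \<le> x i j) - 1 - of_bool (i' = i))"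
  proof (rule sum.cong[OF refl])
    fix i' assume "i' \<in> {1..n}"
    then have "i' \<noteq> i \<Longrightarrow> x i' j \<noteq> x i j" using inj_onD[OF assms(1)] assms(2) by blast
    then show "sgn (x i j - x i' j) = 2 * of_bool (x i' j \<le> x i j) - 1 - of_bool (i' = i)"
      by (cases "i' = i") (auto simp: sgn_real_def)
  qed
  also have "\<dots> = 2 * real (obs_rank n x j i) - real n - 1"
  proof -
    have "(\<Sum>i'\<in>{1..n}. of_bool (i' = i) :: real) = 1"
      using assms(2) by (simp add: of_bool_def)
    moreover have "(\<Sum>i'\<in>{1..n}. of_bool (x i' j \<le> x i j) :: real) = real (obs_rank n x j i)"
      by (simp add: sum_of_bool_eq obs_rank_def Int_def)
    ultimately show ?thesis
      by (simp add: sum_subtractf sum_distrib_left[symmetric])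
  qed
  finally show ?thesis unfolding diff_divide_distrib by (simp add: field_simps)
qed

lemma bij_betw_obs_rank:
  assumes "inj_on (\<lambda>i. x i j) {1..n}"
  shows "bij_betw (obs_rank n x j) {1..n} {1..n}"
proof -
  have less: "obs_rank n x j i < obs_rank n x j i'" if "i' \<in> {1..n}" "x i j < x i' j" for i i'
  proof -
    let ?A = "{i''\<in>{1..n}. x i'' j \<le> x i j}" and ?B = "{i''\<in>{1..n}. x i'' j \<le> x i' j}"
    have "i' \<in> ?B" "i' \<notin> ?A" using that by simp_all
    moreover have "?A \<subseteq> ?B" using that by auto
    ultimately have "?A \<subset> ?B" by (metis psubsetI)
    then show ?thesis unfolding obs_rank_def by (intro psubset_card_mono) simp
  qed
  have "inj_on (obs_rank n x j) {1..n}"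
  proof (rule inj_onI)
    fix i i' assume "i \<in> {1..n}" "i' \<in> {1..n}" "obs_rank n x j i = obs_rank n x j i'"
    then have "x i j = x i' j" using less[of i i'] less[of i' i] by (cases "x i j" "x i' j" rule: linorder_cases) auto
    then show "i = i'" using assms \<open>i \<in> _\<close> \<open>i' \<in> _\<close> by (blast dest: inj_onD)
  qed
  moreover have "obs_rank n x j ` {1..n} \<subseteq> {1..n}"
  proof safe
    fix i assume i: "i \<in> {1..n}"
    have "obs_rank n x j i \<le> card {1..n}" unfolding obs_rank_def by (rule card_mono) auto
    moreover have "0 < obs_rank n x j i" unfolding obs_rank_def using i by (subst card_gt_0_iff) auto
    ultimately show "obs_rank n x j i \<in> {1..n}" by simp
  qed
  ultimately show ?thesis
    by (simp add: bij_betw_def endo_inj_surj)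
qed

text \<open>Indexing by observations instead of by the ranks in coordinate \<open>j\<close> turns the relative ranks into
  ordinary ranks, and the product of two centred ranks is a double sum of products of signs.\<close>

lemma sum_centred_rel_rank:
  assumes "inj_on (\<lambda>i. x i j) {1..n}" "inj_on (\<lambda>i. x i k) {1..n}"
  shows "(\<Sum>i=1..n. (real i - (real n + 1) / 2) * (real (rel_rank n x j k i) - (real n + 1) / 2))
    = sign_triples n x j k / 4"
proof -
  have bij: "bij_betw (obs_rank n x j) {1..n} {1..n}" by (rule bij_betw_obs_rank) fact
  have rel: "rel_rank n x j k (obs_rank n x j i) = obs_rank n x k i" if "i \<in> {1..n}" for i
  proof -
    have "(THE i'. i' \<in> {1..n} \<and> obs_rank n x j i' = obs_rank n x j i) = i"
      using bij_betw_imp_inj_on[OF bij] that by (intro the_equality) (blast dest: inj_onD)+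
    then show ?thesis by (simp add: rel_rank_def)
  qed
  have "(\<Sum>i=1..n. (real i - (real n + 1) / 2) * (real (rel_rank n x j k i) - (real n + 1) / 2))
    = (\<Sum>i\<in>{1..n}. (real (obs_rank n x j i) - (real n + 1) / 2) *
         (real (rel_rank n x j k (obs_rank n x j i)) - (real n + 1) / 2))"
    by (rule sum.reindex_bij_betw[OF bij, symmetric])
  also have "\<dots> = (\<Sum>i\<in>{1..n}. (\<Sum>i'\<in>{1..n}. sgn (x i j - x i' j)) / 2 * ((\<Sum>i'\<in>{1..n}. sgn (x i k - x i' k)) / 2))"
    by (intro sum.cong refl)
       (simp only: rel centred_rank_eq_sum_sgn[of x j n, OF assms(1)] centred_rank_eq_sum_sgn[of x k n, OF assms(2)])
  also have "\<dots> = sign_triples n x j k / 4"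
    by (simp add: sign_triples_def sum_product sum_divide_distrib)
  finally show ?thesis .
qed

text \<open>The summand is symmetric in the two observations, so the sum over ordered pairs counts every
  unordered pair twice.\<close>

lemma kendall_tau_eq: "kendall_tau n x j k = sign_pairs n x j k / (real n * (real n - 1))"
proof -
  define \<phi> where "\<phi> = (\<lambda>(i, i'). sgn (x i j - x i' j) * sgn (x i k - x i' k))"
  let ?U = "{(i, i'). 1 \<le> i \<and> i < i' \<and> i' \<le> n}"
  have sym: "\<phi> (i, i') = \<phi> (i', i)" for i i'
    by (simp add: \<phi>_def sgn_real_def)
  have swap: "prod.swap ` ?U = {(i, i'). 1 \<le> i' \<and> i' < i \<and> i \<le> n}" by (force simp: image_iff)
  have fin: "finite ?U" by (rule finite_subset[of _ "{1..n} \<times> {1..n}"]) auto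
  have "sign_pairs n x j k = sum \<phi> ({1..n} \<times> {1..n})"
    by (simp add: sign_pairs_def \<phi>_def sum.cartesian_product)
  also have "\<dots> = sum \<phi> (?U \<union> prod.swap ` ?U)"
    unfolding swap by (rule sum.mono_neutral_right) (auto simp: \<phi>_def linorder_neq_iff intro: ccontr)
  also have "\<dots> = sum \<phi> ?U + sum \<phi> (prod.swap ` ?U)"
    using fin by (intro sum.union_disjoint) auto
  also have "sum \<phi> (prod.swap ` ?U) = sum \<phi> ?U"
    by (subst sum.reindex) (auto intro!: sum.cong simp: sym)
  finally have "sign_pairs n x j k = 2 * sum \<phi> ?U" by simp
  moreover have "sum \<phi> ?U = (\<Sum>(i, i')\<in>?U. sgn (x i' j - x i j) * sgn (x i' k - x i k))"
    by (rule sum.cong) (auto simp: \<phi>_def sgn_real_def)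
  ultimately show ?thesis by (simp add: kendall_tau_def)
qed

text \<open>A triple with \<open>i = i'\<close> or \<open>i = i''\<close> contributes zero to the full triple sum; the triples with
  \<open>i' = i''\<close> make up exactly \<open>sign_pairs\<close>.\<close>

lemma rho_hat_eq:
  "rho_hat n x j k = 3 * (sign_triples n x j k - sign_pairs n x j k) / (real n * (real n - 1) * (real n - 2))"
proof -
  define \<phi> where "\<phi> = (\<lambda>(i, i', i''). sgn (x i j - x i' j) * sgn (x i k - x i'' k))"
  let ?D = "{(i, i', i''). {i, i', i''} \<subseteq> {1..n} \<and> i \<noteq> i' \<and> i \<noteq> i'' \<and> i' \<noteq> i''}"
  let ?E = "(\<lambda>(i, i'). (i, i', i')) ` ({1..n} \<times> {1..n})"
  have fin: "finite ?D" by (rule finite_subset[of _ "{1..n} \<times> {1..n} \<times> {1..n}"]) auto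
  have "sign_triples n x j k = sum \<phi> ({1..n} \<times> {1..n} \<times> {1..n})"
    by (simp add: sign_triples_def \<phi>_def sum.cartesian_product)
  also have "\<dots> = sum \<phi> (?D \<union> ?E)"
    by (rule sum.mono_neutral_right) (auto simp: \<phi>_def)
  also have "\<dots> = sum \<phi> ?D + sum \<phi> ?E"
    using fin by (intro sum.union_disjoint) auto
  also have "sum \<phi> ?E = sign_pairs n x j k"
    by (subst sum.reindex)
       (auto simp: inj_on_def \<phi>_def sign_pairs_def sum.cartesian_product intro!: sum.cong)
  finally have "sum \<phi> ?D = sign_triples n x j k - sign_pairs n x j k" by simp
  then show ?thesis by (simp add: rho_hat_def \<phi>_def)
qed

lemma stat_eq_sign_stat:
  assumes "inj_on (\<lambda>i. x i j) {1..n}" "inj_on (\<lambda>i. x i k) {1..n}"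
  shows "stat l n x j k = sign_stat l n x j k"
proof -
  note * = sum_centred_rel_rank[OF assms]
  show ?thesis
    by (cases l) (simp_all only: stat.simps sign_stat.simps spearman_rho_def tau_hat_def kendall_tau_eq
        rho_hat_eq *, simp_all)
qed

lemma abs_sgn_mult_le: "\<bar>sgn (a::real) * sgn b\<bar> \<le> 1"
  by (simp add: abs_mult abs_sgn_eq)

lemma abs_sgn_mult_diff_le: "\<bar>sgn (a::real) * sgn b - sgn c * sgn d\<bar> \<le> 2"
  using abs_sgn_mult_le[of a b] abs_sgn_mult_le[of c d] by linarith

lemma sign_pairs_abs_le: "\<bar>sign_pairs n x j k\<bar> \<le> real n ^ 2"
proof -
  have "\<bar>sign_pairs n x j k\<bar> \<le> (\<Sum>i\<in>{1..n}. \<Sum>i'\<in>{1..n}. 1)"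
    unfolding sign_pairs_def
    by (intro order_trans[OF sum_abs] sum_mono abs_sgn_mult_le)
  then show ?thesis by (simp add: power2_eq_square)
qed

lemma sign_triples_abs_le: "\<bar>sign_triples n x j k\<bar> \<le> real n ^ 3"
proof -
  have "\<bar>sign_triples n x j k\<bar> \<le> (\<Sum>i\<in>{1..n}. \<Sum>i'\<in>{1..n}. \<Sum>i''\<in>{1..n}. 1)"
    unfolding sign_triples_def
    by (intro order_trans[OF sum_abs] sum_mono abs_sgn_mult_le)
  then show ?thesis by (simp add: power3_eq_cube)
qed

text \<open>Only the summands in which the replaced observation occurs can change, and each of them changes by at
  most 2; the same count gives the bound for triples.\<close>

lemma sign_pairs_diff_le:
  assumes "i \<in> {1..n}"
  shows "\<bar>sign_pairs n (x(i := v)) j k - sign_pairs n x j k\<bar> \<le> 4 * real n"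
proof -
  have "\<bar>sign_pairs n (x(i := v)) j k - sign_pairs n x j k\<bar> \<le>
      (\<Sum>a\<in>{1..n}. \<Sum>b\<in>{1..n}. 2 * of_bool (a = i) + 2 * of_bool (b = i))"
    unfolding sign_pairs_def sum_subtractf[symmetric]
    by (intro order_trans[OF sum_abs] sum_mono) (auto simp: abs_sgn_mult_diff_le order_trans[OF abs_sgn_mult_diff_le])
  also have "\<dots> = 4 * real n"
    using assms by (simp add: sum.distrib sum_distrib_left[symmetric])
  finally show ?thesis .
qed

lemma sign_triples_diff_le:
  assumes "i \<in> {1..n}"
  shows "\<bar>sign_triples n (x(i := v)) j k - sign_triples n x j k\<bar> \<le> 6 * real n ^ 2"
proof -
  have "\<bar>sign_triples n (x(i := v)) j k - sign_triples n x j k\<bar> \<le>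
      (\<Sum>a\<in>{1..n}. \<Sum>b\<in>{1..n}. \<Sum>c\<in>{1..n}. 2 * of_bool (a = i) + 2 * of_bool (b = i) + 2 * of_bool (c = i))"
    unfolding sign_triples_def sum_subtractf[symmetric]
    by (intro order_trans[OF sum_abs] sum_mono) (auto simp: abs_sgn_mult_diff_le order_trans[OF abs_sgn_mult_diff_le])
  also have "\<dots> = 6 * real n ^ 2"
    using assms by (simp add: sum.distrib sum_distrib_left[symmetric] power2_eq_square)
  finally show ?thesis .
qed

lemma sign_stat_bounded: "\<exists>B. \<forall>x. \<bar>sign_stat l n x j k\<bar> \<le> B"
proof (cases l)
  case Rho
  then show ?thesis using sign_triples_abs_le[of n _ j k]
    by (intro exI[of _ "3 * real n ^ 3 / \<bar>real n * (real n ^ 2 - 1)\<bar>"]) (auto simp: abs_mult intro!: divide_right_mono)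
next
  case Tau
  then show ?thesis using sign_pairs_abs_le[of n _ j k]
    by (intro exI[of _ "real n ^ 2 / \<bar>real n * (real n - 1)\<bar>"]) (auto simp: abs_mult intro!: divide_right_mono)
next
  case Rho_hat
  have "\<bar>3 * sign_triples n x j k - 3 * sign_pairs n x j k\<bar> \<le> 3 * real n ^ 3 + 3 * real n ^ 2" for x
    using sign_triples_abs_le[of n x j k] sign_pairs_abs_le[of n x j k] by linarith
  then show ?thesis using Rho_hat
    by (intro exI[of _ "3 * (real n ^ 3 + real n ^ 2) / \<bar>real n * (real n - 1) * (real n - 2)\<bar>"])
       (auto simp: abs_mult intro!: divide_right_mono)
next
  case Tau_hat
  then show ?thesis using sign_triples_abs_le[of n _ j k]
    by (intro exI[of _ "2 * real n ^ 3 / \<bar>real n ^ 2 * (real n - 1)\<bar>"]) (auto simp: abs_mult intro!: divide_right_mono)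
qed

text \<open>The constant is dictated by \<open>Rho_hat\<close> at \<open>n = 3\<close>, where the estimates for pairs and triples give
  \<open>99 / n\<close>.\<close>

lemma sign_stat_diff_le:
  assumes n: "3 \<le> n" and i: "i \<in> {1..n}"
  shows "\<bar>sign_stat l n (x(i := v)) j k - sign_stat l n x j k\<bar> \<le> 100 / real n"
proof -
  let ?y = "x(i := v)"
  have P: "\<bar>sign_pairs n ?y j k - sign_pairs n x j k\<bar> \<le> 4 * real n" (is "\<bar>?dP\<bar> \<le> _")
    by (rule sign_pairs_diff_le[OF i])
  have T: "\<bar>sign_triples n ?y j k - sign_triples n x j k\<bar> \<le> 6 * real n ^ 2" (is "\<bar>?dT\<bar> \<le> _")
    by (rule sign_triples_diff_le[OF i])
  have n3: "real n \<ge> 3" using n by simp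
  have bound: "\<bar>a / D\<bar> \<le> 100 / real n" if "\<bar>a\<bar> \<le> b" "0 < D" "b * real n \<le> 100 * D" for a b D :: real
  proof -
    have "\<bar>a\<bar> * real n \<le> 100 * D" using that n3 by (meson mult_right_mono of_nat_0_le_iff order_trans)
    then show ?thesis using that n3 by (simp add: abs_divide field_simps)
  qed
  define m where "m = real n - 3"
  have m: "real n = m + 3" "0 \<le> m" "0 \<le> m * m" "0 \<le> m * (m * m)" using n3 by (simp_all add: m_def)
  show ?thesis
  proof (cases l)
    case Rho
    have "\<bar>3 * ?dT / (real n * (real n ^ 2 - 1))\<bar> \<le> 100 / real n"
      by (rule bound[where b="18 * real n ^ 2"])
         (use T m in \<open>auto simp: power2_eq_square algebra_simps add_pos_nonneg add_nonneg_pos abs_mult\<close>)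
    then show ?thesis using Rho by (simp add: diff_divide_distrib right_diff_distrib)
  next
    case Tau
    have "\<bar>?dP / (real n * (real n - 1))\<bar> \<le> 100 / real n"
      by (rule bound[OF P]) (use m in \<open>auto simp: power2_eq_square algebra_simps add_pos_nonneg add_nonneg_pos\<close>)
    then show ?thesis using Tau by (simp add: diff_divide_distrib)
  next
    case Rho_hat
    have "\<bar>3 * (?dT - ?dP) / (real n * (real n - 1) * (real n - 2))\<bar> \<le> 100 / real n"
      by (rule bound[where b="18 * real n ^ 2 + 12 * real n"])
         (use P T m in \<open>auto simp: power2_eq_square algebra_simps add_pos_nonneg add_nonneg_pos abs_mult\<close>)
    then show ?thesis using Rho_hat by (simp add: diff_divide_distrib[symmetric] algebra_simps)
  next
    case Tau_hat
    have "\<bar>2 * ?dT / (real n ^ 2 * (real n - 1))\<bar> \<le> 100 / real n"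
      by (rule bound[where b="12 * real n ^ 2"])
         (use T m in \<open>auto simp: power2_eq_square algebra_simps add_pos_nonneg add_nonneg_pos abs_mult\<close>)
    then show ?thesis using Tau_hat by (simp add: diff_divide_distrib right_diff_distrib)
  qed
qed

section \<open>Rank statistics under a continuous law\<close>

lemma continuous_lawsD:
  assumes "F \<in> continuous_laws d"
  shows "prob_space F" "sets F = sets (vec_borel d)"
    "\<And>j. j \<in> {1..d} \<Longrightarrow> (\<lambda>v. v j) \<in> borel_measurable F"
proof -
  show F: "prob_space F" "sets F = sets (vec_borel d)"
    using assms by (auto simp: continuous_laws_def)
  show "(\<lambda>v. v j) \<in> borel_measurable F" if "j \<in> {1..d}" for j
    unfolding measurable_cong_sets[OF F(2) refl] vec_borel_def
    using that by (rule measurable_component_singleton)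
qed

lemma continuous_laws_no_atoms:
  assumes "F \<in> continuous_laws d" "j \<in> {1..d}"
  shows "measure F {v \<in> space F. v j = t} = 0"
proof -
  interpret F: prob_space F using assms continuous_lawsD by blast
  have [measurable]: "(\<lambda>v. v j) \<in> borel_measurable F" by (rule continuous_lawsD) fact+
  let ?D = "distr F borel (\<lambda>v. v j)"
  interpret D: prob_space ?D by (rule F.prob_space_distr) measurable
  interpret D: finite_borel_measure ?D by standard simp
  have "isCont (cdf ?D) t"
    using assms by (auto simp: continuous_laws_def continuous_on_eq_continuous_at)
  then have "measure ?D {t} = 0" by (simp add: D.isCont_cdf)
  then show ?thesis
    by (simp add: measure_distr vimage_def Int_def conj_commute)
qed

text \<open>The index \<open>i\<close> is arbitrary, since the description operator in \<open>rel_rank\<close> may yield any number when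
  there are ties; beyond \<open>n\<close> a sample is constantly \<open>undefined\<close>.\<close>

lemma coordinate_measurable:
  assumes "F \<in> continuous_laws d" "j \<in> {1..d}"
  shows "(\<lambda>x. x i j) \<in> borel_measurable (sample_law n F)"
proof (cases "i \<in> {1..n}")
  case True
  then show ?thesis unfolding sample_law_def
    using measurable_compose[of "\<lambda>x. x i" _ F "\<lambda>v. v j" borel] continuous_lawsD(3)[OF assms]
      measurable_component_singleton[of i "{1..n}" "\<lambda>_. F"] by simp
next
  case False
  then have "x i = undefined" if "x \<in> space (sample_law n F)" for x
    using that by (auto simp: sample_law_def space_PiM PiE_def extensional_def)
  then have "(\<lambda>x. x i j) \<in> borel_measurable (sample_law n F) \<longleftrightarrow>
      (\<lambda>_. undefined j :: real) \<in> borel_measurable (sample_law n F)"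
    by (intro measurable_cong) simp
  then show ?thesis by simp
qed

lemma obs_rank_measurable:
  assumes "F \<in> continuous_laws d" "j \<in> {1..d}"
  shows "(\<lambda>x. obs_rank n x j i) \<in> sample_law n F \<rightarrow>\<^sub>M count_space UNIV"
proof -
  have [measurable]: "Measurable.pred (sample_law n F) (\<lambda>x. x i' j \<le> x i j)" for i'
    unfolding pred_def by (intro borel_measurable_le coordinate_measurable[OF assms])
  show ?thesis unfolding obs_rank_def by measurable
qed

text \<open>The described index is a function of the finite random set of observations with rank \<open>i\<close>, whatever
  the description operator returns when that set is not a singleton.\<close>

lemma rel_rank_measurable:
  assumes "F \<in> continuous_laws d" "j \<in> {1..d}" "k \<in> {1..d}"
  shows "(\<lambda>x. rel_rank n x j k i) \<in> sample_law n F \<rightarrow>\<^sub>M count_space UNIV"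
proof -
  have r[measurable]: "(\<lambda>x. obs_rank n x j i') \<in> sample_law n F \<rightarrow>\<^sub>M count_space UNIV" for i'
    by (rule obs_rank_measurable) fact+
  have r'[measurable]: "(\<lambda>x. obs_rank n x k i') \<in> sample_law n F \<rightarrow>\<^sub>M count_space UNIV" for i'
    by (rule obs_rank_measurable) fact+
  define S where "S = (\<lambda>x. {i'\<in>{1..n}. obs_rank n x j i' = i})"
  have "S \<in> sample_law n F \<rightarrow>\<^sub>M count_space (Pow {1..n})"
  proof (subst measurable_count_space_eq_countable)
    show "countable (Pow {1..n})" by (rule countable_finite) simp
    have "S -` {A} \<inter> space (sample_law n F) =
        {x \<in> space (sample_law n F). \<forall>i'\<in>{1..n}. obs_rank n x j i' = i \<longleftrightarrow> i' \<in> A}" if "A \<subseteq> {1..n}" for A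
    proof -
      have "S x = A \<longleftrightarrow> (\<forall>i'\<in>{1..n}. obs_rank n x j i' = i \<longleftrightarrow> i' \<in> A)" for x
        using that unfolding S_def by blast
      then show ?thesis by auto
    qed
    moreover have "{x \<in> space (sample_law n F). \<forall>i'\<in>{1..n}. obs_rank n x j i' = i \<longleftrightarrow> i' \<in> A}
        \<in> sets (sample_law n F)" for A
      by measurable
    ultimately show "S \<in> space (sample_law n F) \<rightarrow> Pow {1..n} \<and>
        (\<forall>A\<in>Pow {1..n}. S -` {A} \<inter> space (sample_law n F) \<in> sets (sample_law n F))"
      by (auto simp: S_def)
  qed
  then have "(\<lambda>x. THE i'. i' \<in> S x) \<in> sample_law n F \<rightarrow>\<^sub>M count_space UNIV"
    by (rule measurable_compose) simp
  then have "(\<lambda>x. obs_rank n x k (THE i'. i' \<in> S x)) \<in> sample_law n F \<rightarrow>\<^sub>M count_space UNIV"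
    by (rule measurable_compose_countable[OF r'])
  then show ?thesis by (simp add: rel_rank_def S_def)
qed

lemma sign_stat_measurable:
  assumes "F \<in> continuous_laws d" "j \<in> {1..d}" "k \<in> {1..d}"
  shows "(\<lambda>x. sign_pairs n x j k) \<in> borel_measurable (sample_law n F)"
    "(\<lambda>x. sign_triples n x j k) \<in> borel_measurable (sample_law n F)"
    "(\<lambda>x. sign_stat l n x j k) \<in> borel_measurable (sample_law n F)"
proof -
  have [measurable]: "(\<lambda>x. x i j) \<in> borel_measurable (sample_law n F)"
     "(\<lambda>x. x i k) \<in> borel_measurable (sample_law n F)" for i
    by (rule coordinate_measurable; fact)+
  show [measurable]: "(\<lambda>x. sign_pairs n x j k) \<in> borel_measurable (sample_law n F)"
    "(\<lambda>x. sign_triples n x j k) \<in> borel_measurable (sample_law n F)"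
    unfolding sign_pairs_def sign_triples_def by measurable
  show "(\<lambda>x. sign_stat l n x j k) \<in> borel_measurable (sample_law n F)"
    by (cases l) simp_all
qed

lemma stat_measurable:
  assumes "F \<in> continuous_laws d" "j \<in> {1..d}" "k \<in> {1..d}"
  shows "(\<lambda>x. stat l n x j k) \<in> borel_measurable (sample_law n F)"
proof -
  note [measurable] = sign_stat_measurable[OF assms]
  have [measurable]: "(\<lambda>x. real (rel_rank n x j k i)) \<in> borel_measurable (sample_law n F)" for i
    by (rule measurable_compose[OF rel_rank_measurable[OF assms]]) simp
  show ?thesis
  proof (cases l)
    case Rho
    then show ?thesis by (simp add: spearman_rho_def)
  next
    case Tau
    then show ?thesis by (simp add: kendall_tau_eq)
  next
    case Rho_hat
    then show ?thesis by (simp add: rho_hat_eq)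
  next
    case Tau_hat
    then show ?thesis by (simp add: tau_hat_def)
  qed
qed

text \<open>Redrawing observation \<open>i\<close> with \<open>i'\<close> kept fixed turns the probability of a tie into the average of
  the probabilities that coordinate \<open>j\<close> hits a given point, which vanish for a continuous law.\<close>

lemma AE_no_ties:
  assumes "F \<in> continuous_laws d" "j \<in> {1..d}"
  shows "AE x in sample_law n F. inj_on (\<lambda>i. x i j) {1..n}"
proof -
  interpret F: prob_space F using assms continuous_lawsD by blast
  interpret S: prob_space "sample_law n F"
    unfolding sample_law_def by (rule prob_space_sample) (rule F.prob_space_axioms)
  have [measurable]: "Measurable.pred (sample_law n F) (\<lambda>x. x i j = x i' j)" for i i'
    unfolding pred_def by (intro borel_measurable_eq coordinate_measurable[OF assms])
  have "AE x in sample_law n F. x i j \<noteq> x i' j" if i: "i \<in> {1..n}" "i' \<in> {1..n}" "i \<noteq> i'" for i i'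
  proof -
    define f where "f = (\<lambda>x :: nat \<Rightarrow> nat \<Rightarrow> real. of_bool (x i j = x i' j) :: real)"
    have fm[measurable]: "f \<in> borel_measurable (sample_law n F)" unfolding f_def by measurable
    have "(\<integral>x. f x \<partial>sample_law n F) = (\<integral>x. (\<integral>v. f (x(i := v)) \<partial>F) \<partial>sample_law n F)"
      unfolding sample_law_def
      by (rule integral_resample[where B=1, OF _ _ F.prob_space_axioms fm[unfolded sample_law_def]])
         (use i in \<open>auto simp: f_def\<close>)
    also have "\<dots> = (\<integral>x. measure F {v \<in> space F. v j = x i' j} \<partial>sample_law n F)"
    proof (rule Bochner_Integration.integral_cong[OF refl])
      fix x
      have "(\<integral>v. f (x(i := v)) \<partial>F) = (\<integral>v. indicator {v \<in> space F. v j = x i' j} v \<partial>F)"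
        using i by (intro Bochner_Integration.integral_cong) (auto simp: f_def)
      then show "(\<integral>v. f (x(i := v)) \<partial>F) = measure F {v \<in> space F. v j = x i' j}"
        by (simp add: Int_absorb2 Collect_restrict)
    qed
    also have "\<dots> = 0" using continuous_laws_no_atoms[OF assms] by simp
    finally have "(\<integral>x. f x \<partial>sample_law n F) = 0" .
    moreover have "integrable (sample_law n F) f"
      by (rule S.integrable_const_bound[where B=1]) (auto simp: f_def)
    ultimately have "AE x in sample_law n F. f x = 0"
      by (subst (asm) integral_nonneg_eq_0_iff_AE) (auto simp: f_def)
    then show ?thesis by eventually_elim (simp add: f_def)
  qed
  then have "AE x in sample_law n F. \<forall>i\<in>{1..n}. \<forall>i'\<in>{1..n}. i \<noteq> i' \<longrightarrow> x i j \<noteq> x i' j"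
    by (intro AE_finite_allI AE_impI) auto
  then show ?thesis by eventually_elim (auto intro!: inj_onI)
qed

lemma AE_stat_eq_sign_stat:
  assumes "F \<in> continuous_laws d" "j \<in> {1..d}" "k \<in> {1..d}"
  shows "AE x in sample_law n F. stat l n x j k = sign_stat l n x j k"
  using AE_no_ties[OF assms(1,2)] AE_no_ties[OF assms(1,3)]
  by eventually_elim (rule stat_eq_sign_stat)

lemma integral_stat_eq:
  assumes "F \<in> continuous_laws d" "j \<in> {1..d}" "k \<in> {1..d}"
  shows "(\<integral>x. stat l n x j k \<partial>sample_law n F) = (\<integral>x. sign_stat l n x j k \<partial>sample_law n F)"
  using AE_stat_eq_sign_stat[OF assms] stat_measurable[OF assms] sign_stat_measurable[OF assms]
  by (intro integral_cong_AE)

lemma variance_stat_le: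
  fixes l :: stat_type
  assumes F: "F \<in> continuous_laws d" "j \<in> {1..d}" "k \<in> {1..d}" and n: "3 \<le> n"
  defines "m \<equiv> \<integral>x. stat l n x j k \<partial>sample_law n F"
  shows "integrable (sample_law n F) (\<lambda>x. (stat l n x j k - m)\<^sup>2)"
    "(\<integral>x. (stat l n x j k - m)\<^sup>2 \<partial>sample_law n F) \<le> 10000 / real n"
proof -
  interpret F: prob_space F using F continuous_lawsD by blast
  interpret S: prob_space "sample_law n F"
    unfolding sample_law_def by (rule prob_space_sample) (rule F.prob_space_axioms)
  note [measurable] = stat_measurable[OF F] sign_stat_measurable[OF F]
  obtain B where B: "\<bar>sign_stat l n x j k\<bar> \<le> B" for x using sign_stat_bounded by metis
  have m: "m = (\<integral>x. sign_stat l n x j k \<partial>sample_law n F)"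
    unfolding m_def by (rule integral_stat_eq) fact+
  have i: "integrable (sample_law n F) (\<lambda>x. sign_stat l n x j k)"
    using B by (intro S.integrable_const_bound[where B=B]) auto
  have "(sign_stat l n x j k)\<^sup>2 \<le> B\<^sup>2" for x
    using B[of x] by (metis abs_ge_zero power2_abs power_mono)
  then have i2: "integrable (sample_law n F) (\<lambda>x. (sign_stat l n x j k)\<^sup>2)"
    by (intro S.integrable_const_bound[where B="B\<^sup>2"]) auto
  have i3: "integrable (sample_law n F) (\<lambda>x. (sign_stat l n x j k - m)\<^sup>2)"
    unfolding power2_diff using i i2 by (intro Bochner_Integration.integrable_add Bochner_Integration.integrable_diff) auto
  have ae: "AE x in sample_law n F. (stat l n x j k - m)\<^sup>2 = (sign_stat l n x j k - m)\<^sup>2"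
    using AE_stat_eq_sign_stat[OF F, of l n] by eventually_elim simp
  show "integrable (sample_law n F) (\<lambda>x. (stat l n x j k - m)\<^sup>2)"
    using i3 ae by (subst integrable_cong_AE[OF _ _ ae]) auto
  have "(\<integral>x. (sign_stat l n x j k)\<^sup>2 \<partial>sample_law n F) \<le> real (card {1..n}) * (100 / real n)\<^sup>2 + m\<^sup>2"
    unfolding m sample_law_def
    by (rule second_moment_bounded_differences[where B=B, OF _ F.prob_space_axioms
          sign_stat_measurable(3)[OF F, of l n, unfolded sample_law_def]])
       (use B sign_stat_diff_le[OF n] in auto)
  also have "real (card {1..n}) * (100 / real n)\<^sup>2 = 10000 / real n"
    using n by (simp add: power2_eq_square field_simps)
  finally have "S.variance (\<lambda>x. sign_stat l n x j k) \<le> 10000 / real n"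
    using S.variance_eq[OF i i2] m by simp
  then show "(\<integral>x. (stat l n x j k - m)\<^sup>2 \<partial>sample_law n F) \<le> 10000 / real n"
    by (subst integral_cong_AE[OF _ _ ae]) (auto simp: m)
qed

lemma prob_stat_deviation_le:
  assumes F: "F \<in> continuous_laws d" "j \<in> {1..d}" "k \<in> {1..d}" and n: "3 \<le> n" and t: "0 < t"
  shows "measure (sample_law n F) {x \<in> space (sample_law n F).
      t \<le> \<bar>stat l n x j k - (\<integral>x. stat l n x j k \<partial>sample_law n F)\<bar>} \<le> 10000 / (real n * t\<^sup>2)"
proof -
  interpret F: prob_space F using F continuous_lawsD by blast
  interpret S: prob_space "sample_law n F"
    unfolding sample_law_def by (rule prob_space_sample) (rule F.prob_space_axioms)
  note [measurable] = stat_measurable[OF F]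
  let ?m = "\<integral>x. stat l n x j k \<partial>sample_law n F"
  have "measure (sample_law n F) {x \<in> space (sample_law n F). t \<le> \<bar>stat l n x j k - ?m\<bar>}
      \<le> (\<integral>x. (stat l n x j k - ?m)\<^sup>2 \<partial>sample_law n F) / t\<^sup>2"
    using variance_stat_le(1)[OF F n] t by (intro S.second_moment_method) auto
  also have "\<dots> \<le> (10000 / real n) / t\<^sup>2"
    using variance_stat_le(2)[OF F n] by (intro divide_right_mono) auto
  finally show ?thesis by simp
qed

section \<open>The uniform law and the sign kernel\<close>

definition unif :: "real measure" where
  "unif = uniform_measure lborel {0..1}"

text \<open>The function \<open>2 G - 1\<close> for the uniform distribution function \<open>G\<close>: it is \<open>2 y - 1\<close> on the unit interval,
  and the truncation keeps it bounded on the whole line, so that the copula density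
  below is nonnegative everywhere.\<close>

definition centred_cdf :: "real \<Rightarrow> real" where
  "centred_cdf y = 2 * max 0 (min 1 y) - 1"

text \<open>The integral operator with kernel \<open>sgn (y - u)\<close>. Its antisymmetry yields all the moments below except
  the mean square of \<open>centred_cdf\<close>.\<close>

definition sgn_transform :: "(real \<Rightarrow> real) \<Rightarrow> real \<Rightarrow> real" where
  "sgn_transform b y = (\<integral>u. b u * sgn (y - u) \<partial>unif)"

lemma sets_unif [measurable_cong, simp]: "sets unif = sets borel"
  by (simp add: unif_def)

lemma space_unif [simp]: "space unif = UNIV"
  by (simp add: unif_def)

interpretation unif: prob_space unif
  unfolding unif_def by (rule prob_space_uniform_measure) simp_all

lemma centred_cdf_measurable [measurable]: "centred_cdf \<in> borel_measurable borel"
  unfolding centred_cdf_def by measurable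

lemma abs_centred_cdf_le: "\<bar>centred_cdf y\<bar> \<le> 1"
  by (auto simp: centred_cdf_def)

lemma integrable_unif:
  fixes a :: "real \<Rightarrow> real"
  assumes "a \<in> borel_measurable borel" "\<And>u. \<bar>a u\<bar> \<le> B"
  shows "integrable unif a"
  using assms by (intro unif.integrable_const_bound[where B=B]) auto

lemma emeasure_unif: "A \<in> sets borel \<Longrightarrow> emeasure unif A = emeasure lborel ({0..1} \<inter> A)"
  by (simp add: unif_def divide_ennreal_def)

lemma measure_unif_lessThan: "measure unif {..<y} = max 0 (min 1 y)"
proof -
  have "{0..1} \<inter> {..<y} = (if y \<le> 0 then {} else if y \<le> 1 then {0..<y} else {0..1})"
    by auto
  then show ?thesis
    by (simp add: emeasure_unif measure_def)
qed

lemma measure_unif_greaterThan: "measure unif {y<..} = 1 - max 0 (min 1 y)"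
proof -
  have "{0..1} \<inter> {y<..} = (if y < 0 then {0..1} else if y \<le> 1 then {y<..1} else {})"
    by auto
  then show ?thesis
    by (simp add: emeasure_unif measure_def)
qed

lemma measure_unif_singleton: "measure unif {t} = 0"
proof -
  have "{0..1} \<inter> {t} = (if 0 \<le> t \<and> t \<le> 1 then {t} else {})" by auto
  then show ?thesis by (simp add: emeasure_unif measure_def)
qed

lemma measure_unif_UNIV [simp]: "measure unif UNIV = 1"
  using unif.prob_space by simp

lemma sgn_transform_one: "sgn_transform (\<lambda>_. 1) y = centred_cdf y"
proof -
  have "sgn_transform (\<lambda>_. 1) y = (\<integral>u. indicator {..<y} u - indicator {y<..} u \<partial>unif)"
    unfolding sgn_transform_def by (rule Bochner_Integration.integral_cong) (auto simp: sgn_real_def)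
  also have "\<dots> = measure unif {..<y} - measure unif {y<..}"
    by (subst Bochner_Integration.integral_diff) (auto intro!: integrable_unif[where B=1] split: split_indicator)
  finally show ?thesis
    by (simp add: measure_unif_lessThan measure_unif_greaterThan centred_cdf_def)
qed

lemma sgn_transform_measurable [measurable]:
  assumes [measurable]: "b \<in> borel_measurable borel"
  shows "sgn_transform b \<in> borel_measurable borel"
  unfolding sgn_transform_def by measurable

lemma abs_sgn_transform_le:
  assumes [measurable]: "b \<in> borel_measurable borel" and b: "\<And>u. \<bar>b u\<bar> \<le> B"
  shows "\<bar>sgn_transform b y\<bar> \<le> B"
proof -
  have B: "\<bar>b u * sgn (y - u)\<bar> \<le> B" for u
    using b[of u] by (auto simp: abs_mult abs_sgn_eq)
  have "\<bar>sgn_transform b y\<bar> \<le> (\<integral>u. \<bar>b u * sgn (y - u)\<bar> \<partial>unif)"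
    unfolding sgn_transform_def by (rule integral_abs_bound)
  also have "\<dots> \<le> B"
    using B by (intro unif.integral_le_const integrable_unif[where B=B] AE_I2) auto
  finally show ?thesis .
qed

text \<open>Fubini and \<open>sgn (y - u) = - sgn (u - y)\<close>.\<close>

lemma sgn_transform_antisym:
  assumes [measurable]: "a \<in> borel_measurable borel" "b \<in> borel_measurable borel"
    and a: "\<And>u. \<bar>a u\<bar> \<le> A" and b: "\<And>u. \<bar>b u\<bar> \<le> B"
  shows "(\<integral>y. a y * sgn_transform b y \<partial>unif) = - (\<integral>y. b y * sgn_transform a y \<partial>unif)"
proof -
  interpret pair_prob_space unif unif ..
  have "0 \<le> A" using a[of 0] by linarith
  have "\<bar>a y * (b u * sgn (y - u))\<bar> \<le> A * B" for y u
    using a[of y] b[of u] \<open>0 \<le> A\<close> 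
    by (auto simp: abs_mult abs_sgn_eq intro!: mult_mono)
  then have int: "integrable (unif \<Otimes>\<^sub>M unif) (\<lambda>(y, u). a y * (b u * sgn (y - u)))"
    by (intro P.integrable_const_bound[where B="A * B"]) auto
  have "(\<integral>y. a y * sgn_transform b y \<partial>unif) = (\<integral>y. (\<integral>u. a y * (b u * sgn (y - u)) \<partial>unif) \<partial>unif)"
    by (simp add: sgn_transform_def)
  also have "\<dots> = (\<integral>u. (\<integral>y. a y * (b u * sgn (y - u)) \<partial>unif) \<partial>unif)"
    using Fubini_integral[OF int] by simp
  also have "\<dots> = (\<integral>u. - (b u * sgn_transform a u) \<partial>unif)"
  proof (rule Bochner_Integration.integral_cong[OF refl])
    fix u
    have "(\<integral>y. a y * (b u * sgn (y - u)) \<partial>unif) = (\<integral>y. - b u * (a y * sgn (u - y)) \<partial>unif)"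
      by (rule Bochner_Integration.integral_cong) (auto simp: sgn_real_def)
    also have "\<dots> = - b u * (\<integral>y. a y * sgn (u - y) \<partial>unif)" by (rule integral_mult_right_zero)
    finally show "(\<integral>y. a y * (b u * sgn (y - u)) \<partial>unif) = - (b u * sgn_transform a u)"
      by (simp add: sgn_transform_def)
  qed
  finally show ?thesis by simp
qed

lemma integral_centred_cdf: "(\<integral>y. centred_cdf y \<partial>unif) = 0"
  using sgn_transform_antisym[of "\<lambda>_. 1" "\<lambda>_. 1" 1 1] by (simp add: sgn_transform_one)

lemma integral_centred_cdf_square: "(\<integral>y. centred_cdf y * centred_cdf y \<partial>unif) = 1 / 3"
proof -
  have unif: "unif = density lborel (\<lambda>x. ennreal (indicator {0..1} x))"
    unfolding unif_def uniform_measure_def by (intro density_cong) (auto split: split_indicator)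
  then have "(\<integral>y. centred_cdf y * centred_cdf y \<partial>unif)
      = (\<integral>y. indicator {0..1} y * (centred_cdf y * centred_cdf y) \<partial>lborel)"
    unfolding unif by (intro integral_real_density) auto
  also have "\<dots> = (\<integral>y. (2 * y - 1)\<^sup>2 * indicator {0..1} y \<partial>lborel)"
    by (rule Bochner_Integration.integral_cong)
       (auto simp: centred_cdf_def power2_eq_square split: split_indicator)
  also have "\<dots> = (2 * 1 - 1) ^ 3 / 6 - (2 * 0 - 1) ^ 3 / 6"
    by (rule integral_FTC_Icc_real) (auto intro!: derivative_eq_intros continuous_intros)
  finally show ?thesis by simp
qed

text \<open>Both follow from antisymmetry: moving the operator from \<open>centred_cdf\<close> to the constant 1 gives
  minus the mean square of \<open>centred_cdf\<close>, and an antisymmetric form vanishes on the diagonal.\<close>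

lemma integral_sgn_transform_centred_cdf:
  "(\<integral>y. sgn_transform centred_cdf y \<partial>unif) = - 1 / 3"
  "(\<integral>y. sgn_transform centred_cdf y * centred_cdf y \<partial>unif) = 0"
  using sgn_transform_antisym[of "\<lambda>_. 1" centred_cdf 1 1]
    sgn_transform_antisym[of centred_cdf centred_cdf 1 1]
  by (simp_all add: sgn_transform_one integral_centred_cdf_square abs_centred_cdf_le mult.commute)

section \<open>The Farlie--Gumbel--Morgenstern alternatives\<close>

definition unif_law :: "nat \<Rightarrow> (nat \<Rightarrow> real) measure" where
  "unif_law d = (\<Pi>\<^sub>M j\<in>{1..d}. unif)"

lemma sets_unif_law [measurable_cong]: "sets (unif_law d) = sets (vec_borel d)"
  unfolding unif_law_def vec_borel_def by (intro sets_PiM_cong) auto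

lemma space_unif_law: "space (unif_law d) = space (vec_borel d)"
  by (rule sets_eq_imp_space_eq[OF sets_unif_law])

interpretation unif_law: prob_space "unif_law d" for d
  unfolding unif_law_def by (rule prob_space_PiM) (rule unif.prob_space_axioms)

lemma unif_law_coordinate:
  "j \<in> {1..d} \<Longrightarrow> (\<lambda>v. v j) \<in> borel_measurable (unif_law d)"
  unfolding measurable_cong_sets[OF sets_unif_law refl] vec_borel_def
  by (rule measurable_component_singleton)

text \<open>Independence of the coordinates, for a product over any subset of them: the missing factors are
  taken to be 1.\<close>

lemma integral_unif_law_prod:
  fixes \<phi> :: "nat \<Rightarrow> real \<Rightarrow> real"
  assumes S: "S \<subseteq> {1..d}"
    and \<phi>: "\<And>i. i \<in> S \<Longrightarrow> \<phi> i \<in> borel_measurable borel" "\<And>i u. i \<in> S \<Longrightarrow> \<bar>\<phi> i u\<bar> \<le> B"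
  shows "(\<integral>v. (\<Prod>i\<in>S. \<phi> i (v i)) \<partial>unif_law d) = (\<Prod>i\<in>S. \<integral>u. \<phi> i u \<partial>unif)"
proof -
  interpret product_sigma_finite "\<lambda>_::nat. unif"
    by (simp add: product_sigma_finite_def unif.sigma_finite_measure_axioms)
  let ?f = "\<lambda>i. if i \<in> S then \<phi> i else (\<lambda>_. 1)"
  have "(\<integral>v. (\<Prod>i\<in>S. \<phi> i (v i)) \<partial>unif_law d) = (\<integral>v. (\<Prod>i\<in>{1..d}. ?f i (v i)) \<partial>unif_law d)"
    by (intro Bochner_Integration.integral_cong refl prod.mono_neutral_cong_left) (use S in auto)
  also have "\<dots> = (\<Prod>i\<in>{1..d}. integral\<^sup>L unif (?f i))"
    unfolding unif_law_def
  proof (rule product_integral_prod)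
    show "integrable unif (?f i)" for i
      using \<phi> by (auto intro!: integrable_unif[where B=B])
  qed simp
  also have "\<dots> = (\<Prod>i\<in>S. \<integral>u. \<phi> i u \<partial>unif)"
    by (intro prod.mono_neutral_cong_right) (use S in \<open>auto simp: unif.prob_space\<close>)
  finally show ?thesis .
qed

lemma integral_unif_law_pair:
  fixes a b :: "real \<Rightarrow> real"
  assumes jk: "j \<in> {1..d}" "k \<in> {1..d}" "j \<noteq> k"
    and m: "a \<in> borel_measurable borel" "b \<in> borel_measurable borel"
    and bound: "\<And>u. \<bar>a u\<bar> \<le> A" "\<And>u. \<bar>b u\<bar> \<le> B"
  shows "(\<integral>v. a (v j) * b (v k) \<partial>unif_law d) = (\<integral>u. a u \<partial>unif) * (\<integral>u. b u \<partial>unif)"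
proof -
  let ?\<phi> = "\<lambda>i. if i = j then a else b"
  have "(\<integral>v. (\<Prod>i\<in>{j, k}. ?\<phi> i (v i)) \<partial>unif_law d) = (\<Prod>i\<in>{j, k}. \<integral>u. ?\<phi> i u \<partial>unif)"
    using jk m order_trans[OF bound(1) max.cobounded1[of A B]] order_trans[OF bound(2) max.cobounded2[of B A]]
    by (intro integral_unif_law_prod[where B="max A B"]) auto
  then show ?thesis using jk by simp
qed

lemma integrable_unif_law:
  fixes f :: "(nat \<Rightarrow> real) \<Rightarrow> real"
  assumes "f \<in> borel_measurable (unif_law d)" "\<And>v. \<bar>f v\<bar> \<le> B"
  shows "integrable (unif_law d) f"
  using assms by (intro unif_law.integrable_const_bound[where B=B]) auto

definition fgm_density :: "real \<Rightarrow> nat \<Rightarrow> nat \<Rightarrow> (nat \<Rightarrow> real) \<Rightarrow> real" where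
  "fgm_density \<theta> j k v = 1 + \<theta> * (centred_cdf (v j) * centred_cdf (v k))"

text \<open>The uniform law on the cube with a Farlie--Gumbel--Morgenstern copula in the pair \<open>(j, k)\<close>.\<close>

definition fgm_law :: "nat \<Rightarrow> real \<Rightarrow> nat \<Rightarrow> nat \<Rightarrow> (nat \<Rightarrow> real) measure" where
  "fgm_law d \<theta> j k = density (unif_law d) (\<lambda>v. ennreal (fgm_density \<theta> j k v))"

lemma fgm_law_zero: "fgm_law d 0 j k = unif_law d"
  by (simp add: fgm_law_def fgm_density_def density_1)

lemma abs_centred_cdf_mult_le: "\<bar>centred_cdf u * centred_cdf v\<bar> \<le> 1"
  using mult_mono[OF abs_centred_cdf_le[of u] abs_centred_cdf_le[of v]] by (simp add: abs_mult)

lemma fgm_density_bounds: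
  assumes "0 \<le> \<theta>" "\<theta> \<le> 1"
  shows "0 \<le> fgm_density \<theta> j k v" "fgm_density \<theta> j k v \<le> 2"
proof -
  have "\<bar>\<theta> * (centred_cdf (v j) * centred_cdf (v k))\<bar> \<le> 1 * 1"
    unfolding abs_mult[of \<theta>] using assms by (intro mult_mono abs_centred_cdf_mult_le) auto
  then show "0 \<le> fgm_density \<theta> j k v" "fgm_density \<theta> j k v \<le> 2"
    by (auto simp: fgm_density_def)
qed

lemma fgm_density_measurable:
  assumes "j \<in> {1..d}" "k \<in> {1..d}"
  shows "fgm_density \<theta> j k \<in> borel_measurable (unif_law d)"
proof -
  note [measurable] = unif_law_coordinate[OF assms(1)] unif_law_coordinate[OF assms(2)]
  show ?thesis unfolding fgm_density_def[abs_def] by measurable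
qed

lemma integral_fgm_law:
  fixes f :: "(nat \<Rightarrow> real) \<Rightarrow> real"
  assumes "j \<in> {1..d}" "k \<in> {1..d}" "0 \<le> \<theta>" "\<theta> \<le> 1" "f \<in> borel_measurable (unif_law d)"
  shows "(\<integral>v. f v \<partial>fgm_law d \<theta> j k) = (\<integral>v. fgm_density \<theta> j k v * f v \<partial>unif_law d)"
  unfolding fgm_law_def using assms fgm_density_measurable fgm_density_bounds
  by (intro integral_real_density) auto

text \<open>Expanding the density splits the integral into the value under independence and \<open>\<theta>\<close> times the
  product of the two correlations with \<open>centred_cdf\<close>. This is the only computation with the copula that
  the means of the statistics need.\<close>

lemma integral_fgm_law_pair:
  fixes a b :: "real \<Rightarrow> real"
  assumes jk: "j \<in> {1..d}" "k \<in> {1..d}" "j \<noteq> k" and \<theta>: "0 \<le> \<theta>" "\<theta> \<le> 1"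
    and m[measurable]: "a \<in> borel_measurable borel" "b \<in> borel_measurable borel"
    and bound: "\<And>u. \<bar>a u\<bar> \<le> A" "\<And>u. \<bar>b u\<bar> \<le> B"
  shows "(\<integral>v. a (v j) * b (v k) \<partial>fgm_law d \<theta> j k) =
    (\<integral>u. a u \<partial>unif) * (\<integral>u. b u \<partial>unif) +
    \<theta> * ((\<integral>u. a u * centred_cdf u \<partial>unif) * (\<integral>u. b u * centred_cdf u \<partial>unif))"
proof -
  note [measurable] = unif_law_coordinate[OF jk(1)] unif_law_coordinate[OF jk(2)]
  have A: "0 \<le> A" using bound(1)[of 0] by linarith
  have ag: "\<bar>a u * centred_cdf u\<bar> \<le> A" for u
    using mult_mono[OF bound(1)[of u] abs_centred_cdf_le[of u]] A by (simp add: abs_mult)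
  have B: "0 \<le> B" using bound(2)[of 0] by linarith
  have bg: "\<bar>b u * centred_cdf u\<bar> \<le> B" for u
    using mult_mono[OF bound(2)[of u] abs_centred_cdf_le[of u]] B by (simp add: abs_mult)
  have i1: "integrable (unif_law d) (\<lambda>v. a (v j) * b (v k))"
    by (rule integrable_unif_law[where B="A * B"])
       (use A bound in \<open>auto simp: abs_mult intro!: mult_mono\<close>)
  have "integrable (unif_law d) (\<lambda>v. (a (v j) * centred_cdf (v j)) * (b (v k) * centred_cdf (v k)))"
    by (rule integrable_unif_law[where B="A * B"])
       (use A ag bg in \<open>auto simp: abs_mult[of "a _ * _"] intro!: mult_mono\<close>)
  note i2 = integrable_mult_right[OF this, of \<theta>]
  have "(\<integral>v. a (v j) * b (v k) \<partial>fgm_law d \<theta> j k) = (\<integral>v. a (v j) * b (v k) +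
      \<theta> * ((a (v j) * centred_cdf (v j)) * (b (v k) * centred_cdf (v k))) \<partial>unif_law d)"
    using jk \<theta> by (subst integral_fgm_law) (auto simp: fgm_density_def algebra_simps)
  also have "\<dots> = (\<integral>v. a (v j) * b (v k) \<partial>unif_law d) +
      \<theta> * (\<integral>v. (a (v j) * centred_cdf (v j)) * (b (v k) * centred_cdf (v k)) \<partial>unif_law d)"
    using i1 i2 by simp
  also have "(\<integral>v. (a (v j) * centred_cdf (v j)) * (b (v k) * centred_cdf (v k)) \<partial>unif_law d) =
      (\<integral>u. a u * centred_cdf u \<partial>unif) * (\<integral>u. b u * centred_cdf u \<partial>unif)"
    by (rule integral_unif_law_pair[OF jk, where A=A and B=B]) (use ag bg in auto)
  also have "(\<integral>v. a (v j) * b (v k) \<partial>unif_law d) = (\<integral>u. a u \<partial>unif) * (\<integral>u. b u \<partial>unif)"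
    by (rule integral_unif_law_pair[OF jk m bound])
  finally show ?thesis .
qed

lemma prob_space_fgm_law:
  assumes jk: "j \<in> {1..d}" "k \<in> {1..d}" "j \<noteq> k" and \<theta>: "0 \<le> \<theta>" "\<theta> \<le> 1"
  shows "prob_space (fgm_law d \<theta> j k)"
proof
  note [measurable] = fgm_density_measurable[OF jk(1,2)]
  have "emeasure (fgm_law d \<theta> j k) (space (fgm_law d \<theta> j k)) = (\<integral>\<^sup>+v. ennreal (fgm_density \<theta> j k v) \<partial>unif_law d)"
    unfolding fgm_law_def by (auto simp: emeasure_density intro!: nn_integral_cong)
  also have "\<dots> = ennreal (\<integral>v. fgm_density \<theta> j k v \<partial>unif_law d)"
    using fgm_density_bounds[OF \<theta>]
    by (intro nn_integral_eq_integral integrable_unif_law[where B=2]) auto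
  also have "(\<integral>v. fgm_density \<theta> j k v \<partial>unif_law d) = 1"
    using integral_fgm_law[OF jk(1,2) \<theta>, of "\<lambda>_. 1"]
      integral_fgm_law_pair[OF jk \<theta>, of "\<lambda>_. 1" "\<lambda>_. 1" 1 1]
    by (simp add: integral_centred_cdf unif.prob_space)
  finally show "emeasure (fgm_law d \<theta> j k) (space (fgm_law d \<theta> j k)) = 1" by simp
qed

text \<open>The law is absolutely continuous with respect to the product law, so it inherits that hyperplanes
  orthogonal to a coordinate axis are null sets.\<close>

lemma fgm_law_continuous:
  assumes jk: "j \<in> {1..d}" "k \<in> {1..d}" "j \<noteq> k" and \<theta>: "0 \<le> \<theta>" "\<theta> \<le> 1"
  shows "fgm_law d \<theta> j k \<in> continuous_laws d"
  unfolding continuous_laws_def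
proof (intro CollectI conjI ballI)
  let ?F = "fgm_law d \<theta> j k"
  show "prob_space ?F" by (rule prob_space_fgm_law) fact+
  then interpret F: prob_space ?F .
  show sF: "sets ?F = sets (vec_borel d)" by (simp add: fgm_law_def sets_unif_law)
  fix i assume i: "i \<in> {1..d}"
  note [measurable] = fgm_density_measurable[OF jk(1,2)]
  have [measurable]: "(\<lambda>v. v i) \<in> borel_measurable (unif_law d)" by (rule unif_law_coordinate) fact
  have m[measurable]: "(\<lambda>v. v i) \<in> borel_measurable ?F"
    unfolding fgm_law_def by simp
  let ?D = "distr ?F borel (\<lambda>v. v i)"
  interpret D: prob_space ?D by (rule F.prob_space_distr) (rule m)
  interpret D: finite_borel_measure ?D by standard simp
  have "isCont (cdf ?D) t" for t
  proof -
    let ?A = "{v \<in> space (unif_law d). v i = t}"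
    have "measure (unif_law d) ?A = (\<integral>v. (\<Prod>l\<in>{i}. indicator {t} (v l)) \<partial>unif_law d)"
      by (subst Bochner_Integration.integral_cong[where g="indicator ?A" and N="unif_law d"])
         (auto split: split_indicator)
    also have "\<dots> = (\<Prod>l\<in>{i}. \<integral>u. indicator {t} u \<partial>unif)"
      by (rule integral_unif_law_prod[where B=1]) (use i in auto)
    also have "\<dots> = 0"
      by (simp add: measure_unif_singleton)
    finally have "?A \<in> null_sets (unif_law d)"
      by (simp add: null_sets_def unif_law.emeasure_eq_measure)
    then have "?A \<in> null_sets ?F"
      using absolutely_continuousI_density[of "\<lambda>v. ennreal (fgm_density \<theta> j k v)" "unif_law d"]
      by (auto simp: absolutely_continuous_def fgm_law_def)
    moreover have "(\<lambda>v. v i) -` {t} \<inter> space ?F = ?A"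
      by (auto simp: fgm_law_def)
    ultimately have "measure ?D {t} = measure ?F ?A" "measure ?F ?A = 0"
      by (simp_all add: measure_distr measure_eq_0_null_sets)
    then show ?thesis by (simp add: D.isCont_cdf)
  qed
  then show "continuous_on UNIV (cdf ?D)" by (simp add: continuous_on_eq_continuous_at)
qed

lemma unif_law_null:
  assumes "1 \<le> d"
  shows "unif_law d \<in> null_laws d"
proof -
  interpret unif_product: product_prob_space "\<lambda>_::nat. unif" "{1..d}" by standard
  have m: "(\<lambda>v. v j) \<in> borel_measurable (unif_law d)" if "j \<in> {1..d}" for j
    by (rule unif_law_coordinate) fact
  have D: "distr (unif_law d) borel (\<lambda>v. v j) = unif" if "j \<in> {1..d}" for j
  proof -
    have "distr (unif_law d) borel (\<lambda>v. v j) = distr (unif_law d) unif (\<lambda>v. v j)"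
      by (rule distr_cong) auto
    also have "\<dots> = unif" unfolding unif_law_def using that by (intro unif_product.PiM_component)
    finally show ?thesis .
  qed
  have "unif_law d \<in> continuous_laws d"
    unfolding continuous_laws_def
  proof (intro CollectI conjI ballI)
    fix j assume j: "j \<in> {1..d}"
    interpret U: finite_borel_measure unif by standard simp
    have "isCont (cdf unif) t" for t
      unfolding U.isCont_cdf by (simp add: measure_unif_singleton)
    then show "continuous_on UNIV (cdf (distr (unif_law d) borel (\<lambda>v. v j)))"
      by (simp add: D[OF j] continuous_on_eq_continuous_at)
  qed (simp_all add: sets_unif_law unif_law.prob_space_axioms)
  moreover have "unif_law.indep_vars d (\<lambda>_. borel) (\<lambda>j v. v j) {1..d}"
  proof (subst unif_law.indep_vars_iff_distr_eq_PiM')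
    show "{1..d} \<noteq> {}" using assms by auto
    have "distr (unif_law d) (\<Pi>\<^sub>M i\<in>{1..d}. borel) (\<lambda>x. \<lambda>i\<in>{1..d}. x i) = distr (unif_law d) (unif_law d) (\<lambda>x. x)"
    proof (rule distr_cong)
      show "sets (\<Pi>\<^sub>M i\<in>{1..d}. borel) = sets (unif_law d)" by (simp add: sets_unif_law vec_borel_def)
      fix x assume "x \<in> space (unif_law d)"
      then show "(\<lambda>i\<in>{1..d}. x i) = x"
        by (intro extensional_restrict) (simp add: space_unif_law vec_borel_def space_PiM PiE_def)
    qed simp
    also have "\<dots> = unif_law d" by (rule distr_id)
    also have "\<dots> = (\<Pi>\<^sub>M i\<in>{1..d}. distr (unif_law d) borel (\<lambda>v. v i))"
      unfolding unif_law_def[of d] by (rule PiM_cong) (use D in \<open>auto simp: unif_law_def\<close>)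
    finally show "distr (unif_law d) (\<Pi>\<^sub>M i\<in>{1..d}. borel) (\<lambda>x. \<lambda>i\<in>{1..d}. x i)
       = (\<Pi>\<^sub>M i\<in>{1..d}. distr (unif_law d) borel (\<lambda>v. v i))" .
  qed (use m in auto)
  ultimately show ?thesis by (simp add: null_laws_def)
qed

section \<open>Means of the statistics under the alternatives\<close>

lemma integral_sample_law_observation:
  fixes h :: "(nat \<Rightarrow> real) \<Rightarrow> real"
  assumes "prob_space F" "i \<in> {1..n}" and [measurable]: "h \<in> borel_measurable F"
  shows "(\<integral>x. h (x i) \<partial>sample_law n F) = (\<integral>v. h v \<partial>F)"
proof -
  interpret F: prob_space F by fact
  interpret product_prob_space "\<lambda>_::nat. F" "{1..n}" by standard
  have "(\<integral>v. h v \<partial>F) = (\<integral>v. h v \<partial>distr (\<Pi>\<^sub>M i\<in>{1..n}. F) F (\<lambda>x. x i))"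
    using PiM_component[OF assms(2)] by simp
  also have "\<dots> = (\<integral>x. h (x i) \<partial>sample_law n F)"
    unfolding sample_law_def by (rule integral_distr) (use assms(2) in auto)
  finally show ?thesis ..
qed

lemma integral_sgn_unif:
  "(\<integral>u. sgn (y - u) \<partial>unif) = centred_cdf y"
  "(\<integral>u. sgn (y - u) * centred_cdf u \<partial>unif) = sgn_transform centred_cdf y"
  using sgn_transform_one[of y] by (simp_all add: sgn_transform_def mult.commute)

text \<open>The slope of the mean in \<open>\<theta>\<close>. Under the copula Kendall's tau is \<open>2 \<theta> / 9\<close> and Spearman's rho is
  \<open>\<theta> / 3\<close>; the finite-sample statistic \<open>Rho\<close> is the mixture \<open>((n - 2) Rho_hat + 3 Tau) / (n + 1)\<close>.\<close>

definition fgm_mean_coeff :: "stat_type \<Rightarrow> nat \<Rightarrow> real" where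
  "fgm_mean_coeff l n = (case l of Rho \<Rightarrow> real n / (3 * (real n + 1)) | Tau \<Rightarrow> 2 / 9
     | Rho_hat \<Rightarrow> 1 / 3 | Tau_hat \<Rightarrow> 2 / 9)"

context
  fixes d j k :: nat and \<theta> :: real
  assumes jk: "j \<in> {1..d}" "k \<in> {1..d}" "j \<noteq> k" and \<theta>: "0 \<le> \<theta>" "\<theta> \<le> 1"
begin

text \<open>The conditional mean of a product of signs given one of its two observations: the first term is the value
  under independence.\<close>

lemma integral_fgm_law_sgn_pair:
  "(\<integral>v. sgn (y - v j) * sgn (z - v k) \<partial>fgm_law d \<theta> j k) = centred_cdf y * centred_cdf z +
     \<theta> * (sgn_transform centred_cdf y * sgn_transform centred_cdf z)"
  by (subst integral_fgm_law_pair[OF jk \<theta>, where A=1 and B=1])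
     (simp_all add: abs_sgn_eq integral_sgn_unif)

lemma integral_fgm_law_sgn:
  "(\<integral>v. sgn (y - v j) \<partial>fgm_law d \<theta> j k) = centred_cdf y"
  "(\<integral>v. sgn (y - v k) \<partial>fgm_law d \<theta> j k) = centred_cdf y"
  using integral_fgm_law_pair[OF jk \<theta>, of "\<lambda>u. sgn (y - u)" "\<lambda>_. 1" 1 1]
    integral_fgm_law_pair[OF jk \<theta>, of "\<lambda>_. 1" "\<lambda>u. sgn (y - u)" 1 1]
  by (simp_all add: abs_sgn_eq integral_centred_cdf integral_sgn_unif)

lemma integral_fgm_law_centred_cdf:
  "(\<integral>v. centred_cdf (v j) * centred_cdf (v k) \<partial>fgm_law d \<theta> j k) = \<theta> / 9"
  by (subst integral_fgm_law_pair[OF jk \<theta>, where A=1 and B=1])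
     (simp_all add: abs_centred_cdf_le integral_centred_cdf integral_centred_cdf_square)

lemma integral_fgm_law_sgn_transform:
  "(\<integral>v. sgn_transform centred_cdf (v j) * sgn_transform centred_cdf (v k) \<partial>fgm_law d \<theta> j k) = 1 / 9"
  by (subst integral_fgm_law_pair[OF jk \<theta>, where A=1 and B=1])
     (simp_all add: abs_centred_cdf_le abs_sgn_transform_le integral_sgn_transform_centred_cdf)

lemma fgm_sample_coordinate:
  "(\<lambda>x. x i j) \<in> borel_measurable (sample_law n (fgm_law d \<theta> j k))"
  "(\<lambda>x. x i k) \<in> borel_measurable (sample_law n (fgm_law d \<theta> j k))"
  using coordinate_measurable[OF fgm_law_continuous[OF jk \<theta>]] jk by blast+

lemma fgm_coordinate:
  "(\<lambda>v. v j) \<in> borel_measurable (fgm_law d \<theta> j k)"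
  "(\<lambda>v. v k) \<in> borel_measurable (fgm_law d \<theta> j k)"
  using continuous_lawsD(3)[OF fgm_law_continuous[OF jk \<theta>]] jk by blast+

lemma integral_fgm_resample:
  fixes f :: "(nat \<Rightarrow> nat \<Rightarrow> real) \<Rightarrow> real"
  assumes "i \<in> {1..n}" "f \<in> borel_measurable (sample_law n (fgm_law d \<theta> j k))" "\<And>x. \<bar>f x\<bar> \<le> B"
  shows "(\<integral>x. f x \<partial>sample_law n (fgm_law d \<theta> j k)) =
    (\<integral>x. (\<integral>v. f (x(i := v)) \<partial>fgm_law d \<theta> j k) \<partial>sample_law n (fgm_law d \<theta> j k))"
  unfolding sample_law_def
  by (rule integral_resample[where B=B, OF _ _ prob_space_fgm_law[OF jk \<theta>]
        assms(2)[unfolded sample_law_def]]) (use assms in auto)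

text \<open>Redraw \<open>i'\<close> and then \<open>i\<close>. The two terms of the conditional mean contribute \<open>\<theta> / 9\<close> each.\<close>

lemma fgm_sign_pair_mean:
  assumes i: "i \<in> {1..n}" "i' \<in> {1..n}" "i \<noteq> i'"
  shows "(\<integral>x. sgn (x i j - x i' j) * sgn (x i k - x i' k) \<partial>sample_law n (fgm_law d \<theta> j k)) = 2 * \<theta> / 9"
proof -
  let ?F = "fgm_law d \<theta> j k" and ?\<kappa> = "sgn_transform centred_cdf"
  interpret F: prob_space ?F by (rule prob_space_fgm_law[OF jk \<theta>])
  note [measurable] = fgm_sample_coordinate fgm_coordinate
  have b: "\<bar>?\<kappa> y * ?\<kappa> z\<bar> \<le> 1" for y z
    using mult_mono[OF abs_sgn_transform_le[of centred_cdf 1 y] abs_sgn_transform_le[of centred_cdf 1 z]]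
    by (simp add: abs_mult abs_centred_cdf_le)
  have "(\<integral>x. sgn (x i j - x i' j) * sgn (x i k - x i' k) \<partial>sample_law n ?F) =
      (\<integral>x. (\<integral>v. sgn (x i j - v j) * sgn (x i k - v k) \<partial>?F) \<partial>sample_law n ?F)"
    by (subst integral_fgm_resample[where i=i' and B=1]) (use i in \<open>auto simp: abs_sgn_mult_le\<close>)
  also have "\<dots> = (\<integral>x. centred_cdf (x i j) * centred_cdf (x i k) + \<theta> * (?\<kappa> (x i j) * ?\<kappa> (x i k)) \<partial>sample_law n ?F)"
    by (simp only: integral_fgm_law_sgn_pair)
  also have "\<dots> = (\<integral>v. centred_cdf (v j) * centred_cdf (v k) + \<theta> * (?\<kappa> (v j) * ?\<kappa> (v k)) \<partial>?F)"
    by (rule integral_sample_law_observation[OF F.prob_space_axioms i(1),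
          of "\<lambda>v. centred_cdf (v j) * centred_cdf (v k) + \<theta> * (?\<kappa> (v j) * ?\<kappa> (v k))"]) measurable
  also have "\<dots> = (\<integral>v. centred_cdf (v j) * centred_cdf (v k) \<partial>?F) + \<theta> * (\<integral>v. ?\<kappa> (v j) * ?\<kappa> (v k) \<partial>?F)"
    using b by (subst Bochner_Integration.integral_add)
       (auto intro!: F.integrable_const_bound[where B=1] abs_centred_cdf_mult_le integrable_mult_right)
  finally show ?thesis
    by (simp add: integral_fgm_law_centred_cdf integral_fgm_law_sgn_transform)
qed

text \<open>Redraw \<open>i''\<close> and \<open>i'\<close>, which act on one coordinate each and so see only its uniform marginal; only the
  dependence within observation \<open>i\<close> remains.\<close>

lemma fgm_sign_triple_mean:
  assumes i: "i \<in> {1..n}" "i' \<in> {1..n}" "i'' \<in> {1..n}" "i \<noteq> i'" "i \<noteq> i''" "i' \<noteq> i''"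
  shows "(\<integral>x. sgn (x i j - x i' j) * sgn (x i k - x i'' k) \<partial>sample_law n (fgm_law d \<theta> j k)) = \<theta> / 9"
proof -
  let ?F = "fgm_law d \<theta> j k"
  interpret F: prob_space ?F by (rule prob_space_fgm_law[OF jk \<theta>])
  note [measurable] = fgm_sample_coordinate fgm_coordinate
  have b: "\<bar>sgn (y::real) * centred_cdf z\<bar> \<le> 1" for y z
    using mult_mono[OF _ abs_centred_cdf_le[of z], of "\<bar>sgn y\<bar>" 1] by (simp add: abs_mult abs_sgn_eq)
  have "(\<integral>x. sgn (x i j - x i' j) * sgn (x i k - x i'' k) \<partial>sample_law n ?F) =
      (\<integral>x. (\<integral>v. sgn (x i j - x i' j) * sgn (x i k - v k) \<partial>?F) \<partial>sample_law n ?F)"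
    by (subst integral_fgm_resample[where i=i'' and B=1]) (use i in \<open>auto simp: abs_sgn_mult_le\<close>)
  also have "\<dots> = (\<integral>x. sgn (x i j - x i' j) * centred_cdf (x i k) \<partial>sample_law n ?F)"
    by (simp add: integral_fgm_law_sgn)
  also have "\<dots> = (\<integral>x. (\<integral>v. sgn (x i j - v j) * centred_cdf (x i k) \<partial>?F) \<partial>sample_law n ?F)"
    by (subst integral_fgm_resample[where i=i' and B=1]) (use i b in auto)
  also have "\<dots> = (\<integral>x. centred_cdf (x i j) * centred_cdf (x i k) \<partial>sample_law n ?F)"
    by (simp add: integral_fgm_law_sgn)
  also have "\<dots> = (\<integral>v. centred_cdf (v j) * centred_cdf (v k) \<partial>?F)"
    by (rule integral_sample_law_observation[OF F.prob_space_axioms i(1),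
          of "\<lambda>v. centred_cdf (v j) * centred_cdf (v k)"]) measurable
  finally show ?thesis by (simp add: integral_fgm_law_centred_cdf)
qed

lemma fgm_sign_pairs_mean:
  "(\<integral>x. sign_pairs n x j k \<partial>sample_law n (fgm_law d \<theta> j k)) = real n * (real n - 1) * (2 * \<theta> / 9)"
proof -
  let ?S = "sample_law n (fgm_law d \<theta> j k)"
  interpret S: prob_space ?S
    unfolding sample_law_def by (rule prob_space_sample) (rule prob_space_fgm_law[OF jk \<theta>])
  note [measurable] = fgm_sample_coordinate
  have int: "integrable ?S (\<lambda>x. sgn (x i j - x i' j) * sgn (x i k - x i' k))" for i i'
    by (rule S.integrable_const_bound[where B=1]) (auto simp: abs_sgn_mult_le)
  have "(\<integral>x. sign_pairs n x j k \<partial>?S) =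
      (\<Sum>i\<in>{1..n}. \<Sum>i'\<in>{1..n}. \<integral>x. sgn (x i j - x i' j) * sgn (x i k - x i' k) \<partial>?S)"
    unfolding sign_pairs_def using int by (simp add: Bochner_Integration.integral_sum)
  also have "\<dots> = (\<Sum>i\<in>{1..n}. \<Sum>i'\<in>{1..n}. 2 * \<theta> / 9 * (1 - of_bool (i' = i)))"
  proof (intro sum.cong refl)
    fix i i' assume "i \<in> {1..n}" "i' \<in> {1..n}"
    then show "(\<integral>x. sgn (x i j - x i' j) * sgn (x i k - x i' k) \<partial>?S) = 2 * \<theta> / 9 * (1 - of_bool (i' = i))"
      using fgm_sign_pair_mean[of i n i'] by (cases "i' = i") auto
  qed
  also have "\<dots> = (\<Sum>i\<in>{1..n}. 2 * \<theta> / 9 * (real n - 1))"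
  proof (intro sum.cong refl)
    fix i assume "i \<in> {1..n}"
    then have "(\<Sum>i'\<in>{1..n}. of_bool (i' = i) :: real) = 1" by (simp add: of_bool_def)
    then show "(\<Sum>i'\<in>{1..n}. 2 * \<theta> / 9 * (1 - of_bool (i' = i))) = 2 * \<theta> / 9 * (real n - 1)"
      by (simp only: sum_distrib_left[symmetric] sum_subtractf) simp
  qed
  also have "\<dots> = real n * (real n - 1) * (2 * \<theta> / 9)" by simp
  finally show ?thesis .
qed

text \<open>For fixed \<open>i \<noteq> i'\<close> the means over \<open>i''\<close> are \<open>\<theta> / 9\<close>, except that \<open>i'' = i\<close> gives 0 and \<open>i'' = i'\<close>
  gives twice the value; the two exceptions cancel in the sum.\<close>

lemma fgm_sign_triples_mean:
  "(\<integral>x. sign_triples n x j k \<partial>sample_law n (fgm_law d \<theta> j k)) = real n ^ 2 * (real n - 1) * (\<theta> / 9)"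
proof -
  let ?S = "sample_law n (fgm_law d \<theta> j k)"
  interpret S: prob_space ?S
    unfolding sample_law_def by (rule prob_space_sample) (rule prob_space_fgm_law[OF jk \<theta>])
  note [measurable] = fgm_sample_coordinate
  have int: "integrable ?S (\<lambda>x. sgn (x i j - x i' j) * sgn (x i k - x i'' k))" for i i' i''
    by (rule S.integrable_const_bound[where B=1]) (auto simp: abs_sgn_mult_le)
  have one: "(\<Sum>i'\<in>{1..n}. of_bool (i' = i) :: real) = 1" if "i \<in> {1..n}" for i
    using that by (simp add: of_bool_def)
  have "(\<integral>x. sign_triples n x j k \<partial>?S) =
      (\<Sum>i\<in>{1..n}. \<Sum>i'\<in>{1..n}. \<Sum>i''\<in>{1..n}. \<integral>x. sgn (x i j - x i' j) * sgn (x i k - x i'' k) \<partial>?S)"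
    unfolding sign_triples_def using int by (simp add: Bochner_Integration.integral_sum)
  also have "\<dots> = (\<Sum>i\<in>{1..n}. \<Sum>i'\<in>{1..n}. real n * (\<theta> / 9) * (1 - of_bool (i' = i)))"
  proof (intro sum.cong refl)
    fix i i' assume i: "i \<in> {1..n}" "i' \<in> {1..n}"
    show "(\<Sum>i''\<in>{1..n}. \<integral>x. sgn (x i j - x i' j) * sgn (x i k - x i'' k) \<partial>?S) =
        real n * (\<theta> / 9) * (1 - of_bool (i' = i))"
    proof (cases "i' = i")
      case False
      have "(\<Sum>i''\<in>{1..n}. \<integral>x. sgn (x i j - x i' j) * sgn (x i k - x i'' k) \<partial>?S) =
          (\<Sum>i''\<in>{1..n}. \<theta> / 9 * (1 - of_bool (i'' = i) + of_bool (i'' = i')))"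
      proof (intro sum.cong refl)
        fix i'' assume "i'' \<in> {1..n}"
        then show "(\<integral>x. sgn (x i j - x i' j) * sgn (x i k - x i'' k) \<partial>?S) =
            \<theta> / 9 * (1 - of_bool (i'' = i) + of_bool (i'' = i'))"
          using fgm_sign_triple_mean[of i n i' i''] fgm_sign_pair_mean[of i n i'] i False
          by (cases "i'' = i"; cases "i'' = i'") auto
      qed
      also have "\<dots> = \<theta> / 9 * real n"
        using one i by (simp only: sum_distrib_left[symmetric] sum.distrib sum_subtractf) simp
      finally show ?thesis using False by simp
    qed simp
  qed
  also have "\<dots> = (\<Sum>i\<in>{1..n}. real n * (\<theta> / 9) * (real n - 1))"
  proof (intro sum.cong refl)
    fix i assume "i \<in> {1..n}"
    then show "(\<Sum>i'\<in>{1..n}. real n * (\<theta> / 9) * (1 - of_bool (i' = i))) = real n * (\<theta> / 9) * (real n - 1)"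
      using one by (simp only: sum_distrib_left[symmetric] sum_subtractf) simp
  qed
  also have "\<dots> = real n ^ 2 * (real n - 1) * (\<theta> / 9)" by (simp add: power2_eq_square)
  finally show ?thesis .
qed

lemma fgm_stat_mean:
  assumes n: "3 \<le> n"
  shows "(\<integral>x. stat l n x j k \<partial>sample_law n (fgm_law d \<theta> j k)) = fgm_mean_coeff l n * \<theta>"
proof -
  let ?S = "sample_law n (fgm_law d \<theta> j k)"
  interpret S: prob_space ?S
    unfolding sample_law_def by (rule prob_space_sample) (rule prob_space_fgm_law[OF jk \<theta>])
  note m = sign_stat_measurable(1,2)[OF fgm_law_continuous[OF jk \<theta>] jk(1,2)]
  have i: "integrable ?S (\<lambda>x. sign_pairs n x j k)" "integrable ?S (\<lambda>x. sign_triples n x j k)"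
    using m sign_pairs_abs_le sign_triples_abs_le
    by (auto intro: S.integrable_const_bound[where B="real n ^ 2"] S.integrable_const_bound[where B="real n ^ 3"])
  have D: "(\<integral>x. sign_triples n x j k - sign_pairs n x j k \<partial>?S) = real n * (real n - 1) * (real n - 2) * (\<theta> / 9)"
    using i by (simp add: fgm_sign_pairs_mean fgm_sign_triples_mean power2_eq_square field_simps)
  have nz: "real n \<noteq> 0" "real n - 1 \<noteq> 0" "real n - 2 \<noteq> 0" "real n + 1 \<noteq> 0" using n by auto
  have sq: "real n ^ 2 - 1 = (real n - 1) * (real n + 1)" by (simp add: power2_eq_square algebra_simps)
  have cancel: "3 * (a\<^sup>2 * b * (\<theta> / 9)) / (a * (b * e)) = a / (3 * e) * \<theta>"
    "3 * (a * b * c * (\<theta> / 9)) / (a * b * c) = 1 / 3 * \<theta>"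
    "2 * (a\<^sup>2 * b * (\<theta> / 9)) / (a\<^sup>2 * b) = 2 / 9 * \<theta>"
    "a * b * (2 * \<theta> / 9) / (a * b) = 2 / 9 * \<theta>"
    if "a \<noteq> 0" "b \<noteq> 0" "c \<noteq> 0" "e \<noteq> 0" for a b c e :: real
    using that by (simp_all add: field_simps power2_eq_square)
  have "(\<integral>x. sign_stat l n x j k \<partial>?S) = fgm_mean_coeff l n * \<theta>"
  proof (cases l)
    case Rho
    then show ?thesis using cancel(1)[OF nz]
      by (simp only: sign_stat.simps integral_divide_zero integral_mult_right_zero fgm_sign_triples_mean sq
          fgm_mean_coeff_def stat_type.case)
  next
    case Tau
    then show ?thesis using cancel(4)[OF nz]
      by (simp only: sign_stat.simps integral_divide_zero fgm_sign_pairs_mean fgm_mean_coeff_def stat_type.case)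
  next
    case Rho_hat
    then show ?thesis using cancel(2)[OF nz]
      by (simp only: sign_stat.simps integral_divide_zero integral_mult_right_zero D fgm_mean_coeff_def stat_type.case)
  next
    case Tau_hat
    then show ?thesis using cancel(3)[OF nz]
      by (simp only: sign_stat.simps integral_divide_zero integral_mult_right_zero fgm_sign_triples_mean
          fgm_mean_coeff_def stat_type.case)
  qed
  then show ?thesis
    using integral_stat_eq[OF fgm_law_continuous[OF jk \<theta>] jk(1,2)] by simp
qed

end

lemma fgm_mean_coeff_ge: "3 \<le> n \<Longrightarrow> 1 / 6 \<le> fgm_mean_coeff l n"
  by (cases l) (auto simp: fgm_mean_coeff_def field_simps)

section \<open>Likelihood ratios\<close>

text \<open>Both sides agree on boxes, where the integral of a product of functions of single components
  factorises.\<close>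

lemma PiM_density:
  fixes f :: "'a \<Rightarrow> real"
  assumes I: "finite I" and P: "sigma_finite_measure P" and D: "sigma_finite_measure (density P f)"
    and f[measurable]: "f \<in> borel_measurable P" and pos: "\<And>v. 0 \<le> f v"
  shows "(\<Pi>\<^sub>M i\<in>I. density P f) = density (\<Pi>\<^sub>M i\<in>I. P) (\<lambda>x. ennreal (\<Prod>i\<in>I. f (x i)))"
proof -
  interpret P: product_sigma_finite "\<lambda>_. P" using P by (simp add: product_sigma_finite_def)
  interpret D: product_sigma_finite "\<lambda>_. density P f" using D by (simp add: product_sigma_finite_def)
  have "density (\<Pi>\<^sub>M i\<in>I. P) (\<lambda>x. ennreal (\<Prod>i\<in>I. f (x i))) = (\<Pi>\<^sub>M i\<in>I. density P f)"
  proof (rule D.PiM_eqI[OF I])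
    show "sets (density (\<Pi>\<^sub>M i\<in>I. P) (\<lambda>x. ennreal (\<Prod>i\<in>I. f (x i)))) = sets (\<Pi>\<^sub>M i\<in>I. density P f)"
      by (simp cong: sets_PiM_cong)
    fix A assume "\<And>i. i \<in> I \<Longrightarrow> A i \<in> sets (density P f)"
    then have A: "\<And>i. i \<in> I \<Longrightarrow> A i \<in> sets P" by simp
    have box: "Pi\<^sub>E I A \<in> sets (\<Pi>\<^sub>M i\<in>I. P)" using I A by (intro sets_PiM_I_finite) auto
    have dens: "(\<lambda>x. ennreal (\<Prod>i\<in>I. f (x i))) \<in> borel_measurable (\<Pi>\<^sub>M i\<in>I. P)" by measurable
    have "emeasure (density (\<Pi>\<^sub>M i\<in>I. P) (\<lambda>x. ennreal (\<Prod>i\<in>I. f (x i)))) (Pi\<^sub>E I A) =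
        (\<integral>\<^sup>+x. ennreal (\<Prod>i\<in>I. f (x i)) * indicator (Pi\<^sub>E I A) x \<partial>(\<Pi>\<^sub>M i\<in>I. P))"
      by (rule emeasure_density[OF dens box])
    also have "\<dots> = (\<integral>\<^sup>+x. (\<Prod>i\<in>I. ennreal (f (x i)) * indicator (A i) (x i)) \<partial>(\<Pi>\<^sub>M i\<in>I. P))"
    proof (rule nn_integral_cong)
      fix x assume x: "x \<in> space (\<Pi>\<^sub>M i\<in>I. P)"
      have "indicator (Pi\<^sub>E I A) x = (\<Prod>i\<in>I. indicator (A i) (x i) :: ennreal)"
      proof (cases "x \<in> Pi\<^sub>E I A")
        case True
        then have "(\<Prod>i\<in>I. indicator (A i) (x i) :: ennreal) = (\<Prod>i\<in>I. 1)"
          by (intro prod.cong refl) (simp add: PiE_mem)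
        then show ?thesis using True by simp
      next
        case False
        then obtain i where "i \<in> I" "x i \<notin> A i" using x by (auto simp: space_PiM PiE_def Pi_def)
        then have "(\<Prod>i\<in>I. indicator (A i) (x i) :: ennreal) = 0" using I by (intro prod_zero bexI[of _ i]) auto
        then show ?thesis using False by simp
      qed
      then show "ennreal (\<Prod>i\<in>I. f (x i)) * indicator (Pi\<^sub>E I A) x =
          (\<Prod>i\<in>I. ennreal (f (x i)) * indicator (A i) (x i))"
        using pos by (simp add: prod.distrib prod_ennreal)
    qed
    also have "\<dots> = (\<Prod>i\<in>I. \<integral>\<^sup>+v. ennreal (f v) * indicator (A i) v \<partial>P)"
      using I A by (intro P.product_nn_integral_prod) auto
    also have "\<dots> = (\<Prod>i\<in>I. emeasure (density P f) (A i))"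
      using A by (intro prod.cong refl) (simp add: emeasure_density)
    finally show "emeasure (density (\<Pi>\<^sub>M i\<in>I. P) (\<lambda>x. ennreal (\<Prod>i\<in>I. f (x i)))) (Pi\<^sub>E I A) =
        (\<Prod>i\<in>I. emeasure (density P f) (A i))" .
  qed
  then show ?thesis ..
qed

definition likelihood_ratio :: "nat \<Rightarrow> real \<Rightarrow> nat \<Rightarrow> nat \<Rightarrow> (nat \<Rightarrow> nat \<Rightarrow> real) \<Rightarrow> real" where
  "likelihood_ratio n \<theta> j k x = (\<Prod>i\<in>{1..n}. fgm_density \<theta> j k (x i))"

interpretation null_sample: prob_space "sample_law n (unif_law d)" for n d
  unfolding sample_law_def by (rule prob_space_sample) (rule unif_law.prob_space_axioms)

lemma likelihood_ratio_bounds: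
  assumes "0 \<le> \<theta>" "\<theta> \<le> 1"
  shows "0 \<le> likelihood_ratio n \<theta> j k x" "likelihood_ratio n \<theta> j k x \<le> 2 ^ n"
proof -
  show "0 \<le> likelihood_ratio n \<theta> j k x"
    unfolding likelihood_ratio_def using fgm_density_bounds[OF assms] by (intro prod_nonneg) auto
  have "likelihood_ratio n \<theta> j k x \<le> (\<Prod>i\<in>{1..n}. 2)"
    unfolding likelihood_ratio_def using fgm_density_bounds[OF assms] by (intro prod_mono) auto
  then show "likelihood_ratio n \<theta> j k x \<le> 2 ^ n" by simp
qed

lemma likelihood_ratio_measurable:
  assumes "j \<in> {1..d}" "k \<in> {1..d}"
  shows "likelihood_ratio n \<theta> j k \<in> borel_measurable (sample_law n (unif_law d))"
proof -
  note [measurable] = fgm_density_measurable[OF assms]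
  show ?thesis unfolding likelihood_ratio_def[abs_def] sample_law_def by measurable
qed

lemma fgm_sample_law_density:
  assumes jk: "j \<in> {1..d}" "k \<in> {1..d}" "j \<noteq> k" and \<theta>: "0 \<le> \<theta>" "\<theta> \<le> 1"
  shows "sample_law n (fgm_law d \<theta> j k) =
    density (sample_law n (unif_law d)) (\<lambda>x. ennreal (likelihood_ratio n \<theta> j k x))"
proof -
  interpret F: prob_space "fgm_law d \<theta> j k" by (rule prob_space_fgm_law) fact+
  show ?thesis
    unfolding sample_law_def likelihood_ratio_def fgm_law_def
    by (rule PiM_density)
       (use fgm_density_bounds[OF \<theta>] fgm_density_measurable[OF jk(1,2)] F.sigma_finite_measure_axioms
          unif_law.sigma_finite_measure_axioms in \<open>auto simp: fgm_law_def\<close>)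
qed

lemma integral_fgm_sample_law:
  fixes f :: "(nat \<Rightarrow> nat \<Rightarrow> real) \<Rightarrow> real"
  assumes jk: "j \<in> {1..d}" "k \<in> {1..d}" "j \<noteq> k" and \<theta>: "0 \<le> \<theta>" "\<theta> \<le> 1"
    and f: "f \<in> borel_measurable (sample_law n (unif_law d))"
  shows "(\<integral>x. f x \<partial>sample_law n (fgm_law d \<theta> j k)) =
    (\<integral>x. likelihood_ratio n \<theta> j k x * f x \<partial>sample_law n (unif_law d))"
  unfolding fgm_sample_law_density[OF jk \<theta>]
  using likelihood_ratio_bounds[OF \<theta>] likelihood_ratio_measurable[OF jk(1,2)] f
  by (intro integral_real_density) auto

lemma integral_likelihood_ratio:
  assumes jk: "j \<in> {1..d}" "k \<in> {1..d}" "j \<noteq> k" and \<theta>: "0 \<le> \<theta>" "\<theta> \<le> 1"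
  shows "(\<integral>x. likelihood_ratio n \<theta> j k x \<partial>sample_law n (unif_law d)) = 1"
proof -
  interpret S: prob_space "sample_law n (fgm_law d \<theta> j k)"
    unfolding sample_law_def by (rule prob_space_sample) (rule prob_space_fgm_law[OF jk \<theta>])
  show ?thesis
    using integral_fgm_sample_law[OF jk \<theta>, of "\<lambda>_. 1" n] by (simp add: S.prob_space)
qed

lemma integral_likelihood_ratio_mult:
  assumes jk: "j \<in> {1..d}" "k \<in> {1..d}" "k' \<in> {1..d}" and \<theta>: "0 \<le> \<theta>" "\<theta> \<le> 1"
  shows "(\<integral>x. likelihood_ratio n \<theta> j k x * likelihood_ratio n \<theta> j k' x \<partial>sample_law n (unif_law d)) =
    (\<integral>v. fgm_density \<theta> j k v * fgm_density \<theta> j k' v \<partial>unif_law d) ^ n"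
proof -
  interpret product_sigma_finite "\<lambda>_. unif_law d"
    by (simp add: product_sigma_finite_def unif_law.sigma_finite_measure_axioms)
  note [measurable] = fgm_density_measurable[OF jk(1,2)] fgm_density_measurable[OF jk(1,3)]
  have "\<bar>fgm_density \<theta> j k v * fgm_density \<theta> j k' v\<bar> \<le> 2 * 2" for v
    unfolding abs_mult using fgm_density_bounds[OF \<theta>] by (intro mult_mono) (auto simp: abs_le_iff intro: order_trans)
  then have "integrable (unif_law d) (\<lambda>v. fgm_density \<theta> j k v * fgm_density \<theta> j k' v)"
    by (intro integrable_unif_law[where B=4]) auto
  then have "(\<integral>x. (\<Prod>i\<in>{1..n}. fgm_density \<theta> j k (x i) * fgm_density \<theta> j k' (x i)) \<partial>(\<Pi>\<^sub>M i\<in>{1..n}. unif_law d))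
    = (\<Prod>i\<in>{1..n}. \<integral>v. fgm_density \<theta> j k v * fgm_density \<theta> j k' v \<partial>unif_law d)"
    by (intro product_integral_prod[where f="\<lambda>_ v. fgm_density \<theta> j k v * fgm_density \<theta> j k' v"]) auto
  then show ?thesis by (simp add: likelihood_ratio_def prod.distrib sample_law_def)
qed

text \<open>One factor of the squared density can be absorbed into the law, which leaves the mean of the density
  under the alternative itself.\<close>

lemma likelihood_ratio_second_moment:
  assumes jk: "j \<in> {1..d}" "k \<in> {1..d}" "j \<noteq> k" and \<theta>: "0 \<le> \<theta>" "\<theta> \<le> 1"
  shows "(\<integral>x. likelihood_ratio n \<theta> j k x * likelihood_ratio n \<theta> j k x \<partial>sample_law n (unif_law d)) =
    (1 + \<theta>\<^sup>2 / 9) ^ n"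
proof -
  let ?g = centred_cdf
  have "(\<integral>v. fgm_density \<theta> j k v * fgm_density \<theta> j k v \<partial>unif_law d) =
      (\<integral>v. fgm_density \<theta> j k v \<partial>fgm_law d \<theta> j k)"
    by (rule integral_fgm_law[OF jk(1,2) \<theta>, symmetric]) (rule fgm_density_measurable[OF jk(1,2)])
  also have "\<dots> = (\<integral>v. 1 \<partial>fgm_law d \<theta> j k) + \<theta> * (\<integral>v. ?g (v j) * ?g (v k) \<partial>fgm_law d \<theta> j k)"
  proof -
    interpret F: prob_space "fgm_law d \<theta> j k" by (rule prob_space_fgm_law[OF jk \<theta>])
    note [measurable] = fgm_coordinate[OF jk \<theta>]
    have "integrable (fgm_law d \<theta> j k) (\<lambda>v. ?g (v j) * ?g (v k))"
      by (rule F.integrable_const_bound[where B=1]) (auto simp: abs_centred_cdf_mult_le)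
    then show ?thesis by (simp add: fgm_density_def)
  qed
  also have "\<dots> = 1 + \<theta>\<^sup>2 / 9"
    using prob_space.prob_space[OF prob_space_fgm_law[OF jk \<theta>]]
    by (simp add: integral_fgm_law_centred_cdf[OF jk \<theta>] power2_eq_square)
  finally show ?thesis using integral_likelihood_ratio_mult[OF jk(1,2,2) \<theta>] by simp
qed

text \<open>In the expansion of the product of two densities that share coordinate \<open>j\<close>, every term other than 1
  contains the factor \<open>centred_cdf (v k)\<close> or \<open>centred_cdf (v k')\<close> to the first power, and that factor has mean zero.\<close>

lemma likelihood_ratio_cross_moment:
  assumes jk: "j \<in> {1..d}" "k \<in> {1..d}" "k' \<in> {1..d}" "j \<noteq> k" "j \<noteq> k'" "k \<noteq> k'" and \<theta>: "0 \<le> \<theta>" "\<theta> \<le> 1"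
  shows "(\<integral>x. likelihood_ratio n \<theta> j k x * likelihood_ratio n \<theta> j k' x \<partial>sample_law n (unif_law d)) = 1"
proof -
  let ?g = centred_cdf
  note [measurable] = unif_law_coordinate[OF jk(1)] unif_law_coordinate[OF jk(2)] unif_law_coordinate[OF jk(3)]
  have b: "\<bar>?g a * ?g a * (?g b * ?g c)\<bar> \<le> 1" for a b c
    using mult_mono[OF abs_centred_cdf_mult_le[of a a] abs_centred_cdf_mult_le[of b c]]
    by (simp only: abs_mult) simp
  have i: "integrable (unif_law d) (\<lambda>v. ?g (v j) * ?g (v k))" "integrable (unif_law d) (\<lambda>v. ?g (v j) * ?g (v k'))"
    "integrable (unif_law d) (\<lambda>v. ?g (v j) * ?g (v j) * (?g (v k) * ?g (v k')))"
    using b by (auto intro!: integrable_unif_law[where B=1] abs_centred_cdf_mult_le)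
  have zero: "(\<integral>v. ?g (v j) * ?g (v k) \<partial>unif_law d) = 0" "(\<integral>v. ?g (v j) * ?g (v k') \<partial>unif_law d) = 0"
    using jk by (auto simp: integral_centred_cdf abs_centred_cdf_le integral_unif_law_pair[where A=1 and B=1])
  let ?\<phi> = "\<lambda>i u. if i = j then ?g u * ?g u else ?g u"
  have sq: "?g u * ?g u \<le> 1" for u using abs_centred_cdf_mult_le[of u u] by (rule abs_le_D1)
  have "(\<integral>v. (\<Prod>i\<in>{j, k, k'}. ?\<phi> i (v i)) \<partial>unif_law d) = (\<Prod>i\<in>{j, k, k'}. \<integral>u. ?\<phi> i u \<partial>unif)"
    using jk by (intro integral_unif_law_prod[where B=1])
      (auto simp: abs_centred_cdf_le sq)
  then have zero': "(\<integral>v. ?g (v j) * ?g (v j) * (?g (v k) * ?g (v k')) \<partial>unif_law d) = 0"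
    using jk by (auto simp: integral_centred_cdf)
  have "(\<integral>v. fgm_density \<theta> j k v * fgm_density \<theta> j k' v \<partial>unif_law d) =
      (\<integral>v. 1 + (\<theta> * (?g (v j) * ?g (v k)) + (\<theta> * (?g (v j) * ?g (v k')) +
        \<theta>\<^sup>2 * (?g (v j) * ?g (v j) * (?g (v k) * ?g (v k'))))) \<partial>unif_law d)"
    by (rule Bochner_Integration.integral_cong[OF refl])
       (simp add: fgm_density_def power2_eq_square algebra_simps)
  also have "\<dots> = 1"
    using i zero zero' by (simp add: unif_law.prob_space)
  finally show ?thesis using integral_likelihood_ratio_mult[OF jk(1-3) \<theta>] by simp
qed

lemma integrable_null_sample:
  fixes f :: "(nat \<Rightarrow> nat \<Rightarrow> real) \<Rightarrow> real"
  assumes "f \<in> borel_measurable (sample_law n (unif_law d))" "\<And>x. \<bar>f x\<bar> \<le> B"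
  shows "integrable (sample_law n (unif_law d)) f"
  using assms by (intro null_sample.integrable_const_bound[where B=B]) auto

section \<open>Null variances and projection scales\<close>

lemma null_pair_law_eq: "null_pair_law = unif_law 2"
  by (simp add: null_pair_law_def unif_law_def unif_def)

lemma null_pair_law_continuous: "unif_law 2 \<in> continuous_laws 2"
  using unif_law_null[of 2] by (simp add: null_laws_def)

lemma null_stat_mean:
  assumes "3 \<le> n"
  shows "(\<integral>x. stat l n x 1 2 \<partial>sample_law n null_pair_law) = 0"
  using fgm_stat_mean[where d=2 and j=1 and k=2 and \<theta>=0 and n=n and l=l] assms by (simp add: fgm_law_zero null_pair_law_eq)

lemma null_var_le:
  assumes "3 \<le> n"
  shows "null_var l n \<le> 10000 / real n"
  using variance_stat_le(2)[OF null_pair_law_continuous, where j=1 and k=2 and n=n and l=l] assms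
  by (simp add: null_var_def null_pair_law_eq)

text \<open>The Chapman--Robbins inequality: the shift of the mean under an alternative is the covariance of
  the statistic with the likelihood ratio. With \<open>\<theta> = 1 / sqrt n\<close> the likelihood ratio has bounded
  variance, while the mean is shifted by at least \<open>\<theta> / 6\<close>.\<close>

lemma null_var_ge:
  assumes n: "3 \<le> n"
  shows "1 / (36 * real n) \<le> null_var l n"
proof -
  let ?P = "sample_law n (unif_law 2)"
  define \<theta> where "\<theta> = 1 / sqrt (real n)"
  have \<theta>: "0 \<le> \<theta>" "\<theta> \<le> 1" "\<theta>\<^sup>2 = 1 / real n"
    using n by (auto simp: \<theta>_def power_divide)
  have jk: "1 \<in> {1..2::nat}" "2 \<in> {1..2::nat}" "(1::nat) \<noteq> 2" by auto
  let ?L = "likelihood_ratio n \<theta> 1 2" and ?s = "\<lambda>x. sign_stat l n x 1 2"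
  let ?c = "fgm_mean_coeff l n * \<theta>"
  note meas = likelihood_ratio_measurable[OF jk(1,2), of n \<theta>]
    sign_stat_measurable(3)[OF null_pair_law_continuous jk(1,2), of l n]
    stat_measurable[OF null_pair_law_continuous jk(1,2), of l n]
  note [measurable] = meas meas[unfolded One_nat_def]
  note sm = sign_stat_measurable(3)[OF null_pair_law_continuous jk(1,2), of l n]
  note Lb = likelihood_ratio_bounds[OF \<theta>(1,2), of n 1 2]
  obtain B where B: "\<bar>?s x\<bar> \<le> B" for x using sign_stat_bounded by metis
  have B0: "0 \<le> B" using B[of undefined] by linarith
  have s0: "(\<integral>x. ?s x \<partial>?P) = 0"
    using null_stat_mean[OF n, of l] integral_stat_eq[OF null_pair_law_continuous jk(1,2), where l=l and n=n]
    by (simp add: null_pair_law_eq)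
  have L1: "(\<integral>x. ?L x \<partial>?P) = 1" by (rule integral_likelihood_ratio[OF jk \<theta>(1,2)])
  have L2: "(\<integral>x. ?L x * ?L x \<partial>?P) = (1 + \<theta>\<^sup>2 / 9) ^ n"
    by (rule likelihood_ratio_second_moment[OF jk \<theta>(1,2)])
  have Ls: "(\<integral>x. ?L x * ?s x \<partial>?P) = ?c"
    using integral_fgm_sample_law[OF jk \<theta>(1,2) sm]
      integral_stat_eq[OF fgm_law_continuous[OF jk \<theta>(1,2)] jk(1,2), where l=l and n=n]
      fgm_stat_mean[OF jk \<theta>(1,2) n, of l] by simp
  have iL: "integrable ?P ?L"
    by (rule integrable_null_sample[where B="2 ^ n"]) (use Lb in auto)
  have iLL: "integrable ?P (\<lambda>x. ?L x * ?L x)"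
    by (rule integrable_null_sample[where B="2 ^ n * 2 ^ n"]) (use Lb in \<open>auto simp: abs_mult intro!: mult_mono\<close>)
  have iS: "integrable ?P ?s"
    by (rule integrable_null_sample[where B=B]) (use B in auto)
  have iss: "integrable ?P (\<lambda>x. ?s x * ?s x)"
  proof (rule integrable_null_sample[where B="B * B"])
    show "\<bar>?s x * ?s x\<bar> \<le> B * B" for x
      unfolding abs_mult[of "?s x"] using B B0 by (intro mult_mono) simp_all
  qed measurable
  have iLs: "integrable ?P (\<lambda>x. ?L x * ?s x)"
    by (rule integrable_null_sample[where B="2 ^ n * B"]) (use B Lb in \<open>auto simp: abs_mult intro!: mult_mono\<close>)
  have "null_var l n = (\<integral>x. (stat l n x 1 2)\<^sup>2 \<partial>?P)"
    using null_stat_mean[OF n, of l] by (simp add: null_var_def null_pair_law_eq)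
  also have "\<dots> = (\<integral>x. ?s x * ?s x \<partial>?P)"
    using AE_stat_eq_sign_stat[OF null_pair_law_continuous jk(1,2), of l n]
    by (intro integral_cong_AE) (auto simp: power2_eq_square)
  finally have V: "null_var l n = (\<integral>x. ?s x * ?s x \<partial>?P)" .
  \<comment> \<open>Cauchy--Schwarz in the form of a nonnegative square; the multiplier \<open>?c\<close> suffices because \<open>?L\<close> has variance at most 1.\<close>
  have "0 \<le> (\<integral>x. (?s x - ?c * (?L x - 1))\<^sup>2 \<partial>?P)" by simp
  also have "\<dots> = (\<integral>x. ?s x * ?s x + (- 2 * ?c * (?L x * ?s x) + (2 * ?c * ?s x +
      (?c\<^sup>2 * (?L x * ?L x) + (- 2 * ?c\<^sup>2 * ?L x + ?c\<^sup>2)))) \<partial>?P)"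
    by (rule Bochner_Integration.integral_cong[OF refl]) (simp add: power2_eq_square algebra_simps)
  also have "\<dots> = null_var l n - 2 * ?c * ?c + (?c\<^sup>2 * (1 + \<theta>\<^sup>2 / 9) ^ n - 2 * ?c\<^sup>2 + ?c\<^sup>2)"
    using iL iLL iS iss iLs s0 L1 L2 Ls V by (simp add: null_sample.prob_space)
  finally have "?c\<^sup>2 * (3 - (1 + \<theta>\<^sup>2 / 9) ^ n) \<le> null_var l n"
    by (simp add: power2_eq_square algebra_simps)
  moreover have "(1 + \<theta>\<^sup>2 / 9) ^ n \<le> 2"
  proof -
    have "(1 + \<theta>\<^sup>2 / 9) ^ n \<le> exp (\<theta>\<^sup>2 / 9) ^ n"
      using \<theta> by (intro power_mono exp_ge_add_one_self) auto
    also have "\<dots> = exp (1 / 9)"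
      using \<theta>(3) n by (simp add: exp_of_nat_mult[symmetric])
    also have "\<dots> \<le> 1 + 1 / 9 + (1 / 9)\<^sup>2"
      by (rule exp_bound) auto
    also have "\<dots> \<le> 2" by (simp add: power2_eq_square)
    finally show ?thesis .
  qed
  then have "?c\<^sup>2 * 1 \<le> ?c\<^sup>2 * (3 - (1 + \<theta>\<^sup>2 / 9) ^ n)"
    by (intro mult_left_mono) auto
  moreover have "(\<theta> / 6)\<^sup>2 \<le> ?c\<^sup>2"
    using mult_right_mono[OF fgm_mean_coeff_ge[OF n, of l] \<theta>(1)] \<theta>(1) by (intro power_mono) auto
  moreover have "(\<theta> / 6)\<^sup>2 = 1 / (36 * real n)" using \<theta>(3) by (simp add: power_divide)
  ultimately show ?thesis by linarith
qed

text \<open>If the conditional expectation of \<open>h\<close> given the first observation had variance zero, it would be almost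
  surely constant and so orthogonal to every mean-zero function of that observation, in particular to
  \<open>centred_cdf (x 1 1) * centred_cdf (x 1 2)\<close>. But its inner product with this function is that of \<open>h\<close>.\<close>

lemma projection_scale_pos:
  fixes h :: "(nat \<Rightarrow> nat \<Rightarrow> real) \<Rightarrow> real"
  assumes m: "1 \<le> m" and h[measurable]: "h \<in> borel_measurable (sample_law m null_pair_law)"
    and B: "\<And>x. \<bar>h x\<bar> \<le> B"
    and corr: "(\<integral>x. centred_cdf (x 1 1) * centred_cdf (x 1 2) * h x \<partial>sample_law m null_pair_law) \<noteq> 0"
  shows "0 < projection_scale m h"
proof -
  let ?P = "sample_law m null_pair_law"
  define G where "G = vimage_algebra (space ?P) (\<lambda>x. x 1) null_pair_law"
  define f where "f = (\<lambda>x :: nat \<Rightarrow> nat \<Rightarrow> real. centred_cdf (x 1 1) * centred_cdf (x 1 2))"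
  interpret P: prob_space ?P unfolding null_pair_law_eq by (rule null_sample.prob_space_axioms)
  have x1: "(\<lambda>x. x 1) \<in> ?P \<rightarrow>\<^sub>M null_pair_law"
    unfolding sample_law_def using m by (intro measurable_component_singleton) auto
  have sub: "subalgebra ?P G"
    unfolding subalgebra_def G_def
    using measurable_iff_sets[of "\<lambda>x. x 1" ?P null_pair_law] x1
    by (simp add: measurable_iff_sets)
  interpret G: finite_measure_subalgebra ?P G by (standard, rule sub)
  have x1G: "(\<lambda>x. x 1) \<in> G \<rightarrow>\<^sub>M null_pair_law"
    unfolding G_def by (rule measurable_vimage_algebra1) (use measurable_space[OF x1] in auto)
  have "(\<lambda>v. centred_cdf (v 1) * centred_cdf (v 2)) \<in> borel_measurable null_pair_law"
    using unif_law_coordinate[of 1 2] unif_law_coordinate[of 2 2] unfolding null_pair_law_eq by measurable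
  note f0 = this
  have fG[measurable]: "f \<in> borel_measurable G"
    unfolding f_def using measurable_compose[OF x1G f0] by simp
  have fP[measurable]: "f \<in> borel_measurable ?P"
    unfolding f_def using measurable_compose[OF x1 f0] by simp
  have fB: "\<bar>f x\<bar> \<le> 1" for x unfolding f_def by (rule abs_centred_cdf_mult_le)
  have f_mean: "(\<integral>x. f x \<partial>?P) = 0"
  proof -
    have "(\<integral>x. f x \<partial>?P) = (\<integral>v. centred_cdf (v 1) * centred_cdf (v 2) \<partial>null_pair_law)"
      unfolding f_def
      by (rule integral_sample_law_observation[of null_pair_law 1 m "\<lambda>v. centred_cdf (v 1) * centred_cdf (v 2)"])
         (use m f0 unif_law.prob_space_axioms in \<open>auto simp: null_pair_law_eq\<close>)
    also have "\<dots> = 0"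
      unfolding null_pair_law_eq
      by (subst integral_unif_law_pair[where A=1 and B=1]) (auto simp: abs_centred_cdf_le integral_centred_cdf)
    finally show ?thesis .
  qed
  have ih: "integrable ?P h" using B by (intro P.integrable_const_bound[where B=B]) auto
  define E where "E = real_cond_exp ?P G h"
  have [measurable]: "E \<in> borel_measurable ?P" unfolding E_def by (rule borel_measurable_cond_exp2)
  \<comment> \<open>The conditional expectation inherits the bound on \<open>h\<close>; without integrability of its square a vanishing variance would carry no information.\<close>
  have B': "h x \<le> B" "- B \<le> h x" for x using B[of x] by linarith+
  have "AE x in ?P. E x \<le> B" unfolding E_def by (rule G.real_cond_exp_le_c[OF ih]) (simp add: B')
  moreover have "AE x in ?P. - B \<le> E x" unfolding E_def by (rule G.real_cond_exp_ge_c[OF ih]) (simp add: B')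
  ultimately have EB: "AE x in ?P. \<bar>E x\<bar> \<le> B" by eventually_elim auto
  then have iE: "integrable ?P E" by (intro P.integrable_const_bound[where B=B]) auto
  let ?m = "P.expectation E"
  have "AE x in ?P. norm ((E x - ?m)\<^sup>2) \<le> (B + \<bar>?m\<bar>)\<^sup>2"
    using EB
  proof eventually_elim
    case (elim x)
    then have "\<bar>E x - ?m\<bar> \<le> B + \<bar>?m\<bar>" by linarith
    then show ?case by (metis abs_ge_zero norm_power power_mono real_norm_def)
  qed
  then have iv: "integrable ?P (\<lambda>x. (E x - ?m)\<^sup>2)"
    by (intro P.integrable_const_bound) auto
  have "P.variance E \<noteq> 0"
  proof
    assume "P.variance E = 0"
    then have "AE x in ?P. (E x - ?m)\<^sup>2 = 0"
      using integral_nonneg_eq_0_iff_AE[OF iv] by auto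
    then have ae: "AE x in ?P. f x * E x = f x * ?m" by eventually_elim simp
    have "(\<integral>x. f x * h x \<partial>?P) = (\<integral>x. f x * E x \<partial>?P)"
      unfolding E_def
    proof (rule G.real_cond_exp_intg(2)[symmetric])
      show "integrable ?P (\<lambda>x. f x * h x)"
        using mult_mono[OF fB B]
        by (intro P.integrable_const_bound[where B="1 * B"] AE_I2) (auto simp: abs_mult)
    qed measurable
    also have "\<dots> = (\<integral>x. f x * ?m \<partial>?P)"
      by (rule integral_cong_AE[OF _ _ ae]) auto
    also have "\<dots> = 0" using f_mean by simp
    finally show False using corr by (simp add: f_def)
  qed
  then have "0 < P.variance E" using P.variance_positive[of E] by linarith
  then show ?thesis
    using m by (simp add: projection_scale_def null_cond_exp_first_def Let_def E_def G_def)
qed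

lemma null_coordinate:
  assumes "j \<in> {1, 2}"
  shows "(\<lambda>x. x i j) \<in> borel_measurable (sample_law m null_pair_law)"
  using coordinate_measurable[OF null_pair_law_continuous, of j] assms by (auto simp: null_pair_law_eq)

lemma null_resample:
  fixes f :: "(nat \<Rightarrow> nat \<Rightarrow> real) \<Rightarrow> real"
  assumes "i \<in> {1..n}" "f \<in> borel_measurable (sample_law n null_pair_law)" "\<And>x. \<bar>f x\<bar> \<le> B"
  shows "(\<integral>x. f x \<partial>sample_law n null_pair_law) =
    (\<integral>x. (\<integral>v. f (x(i := v)) \<partial>null_pair_law) \<partial>sample_law n null_pair_law)"
  using integral_fgm_resample[of 1 2 2 0 i n f B] assms by (simp add: fgm_law_zero null_pair_law_eq)

lemma null_square_moment:
  assumes "1 \<le> m"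
  shows "(\<integral>x. centred_cdf (x 1 1) * centred_cdf (x 1 2) * (centred_cdf (x 1 1) * centred_cdf (x 1 2))
    \<partial>sample_law m null_pair_law) = 1 / 9"
proof -
  let ?h = "\<lambda>v :: nat \<Rightarrow> real. centred_cdf (v 1) * centred_cdf (v 2) * (centred_cdf (v 1) * centred_cdf (v 2))"
  have [measurable]: "(\<lambda>v. v 1) \<in> borel_measurable (unif_law 2)" "(\<lambda>v. v 2) \<in> borel_measurable (unif_law 2)"
    by (auto intro: unif_law_coordinate)
  have meas: "?h \<in> borel_measurable (unif_law 2)" by measurable
  have "(\<integral>x. ?h (x 1) \<partial>sample_law m null_pair_law) = (\<integral>v. ?h v \<partial>unif_law 2)"
    unfolding null_pair_law_eq
    by (rule integral_sample_law_observation[OF unif_law.prob_space_axioms _ meas]) (use assms in auto)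
  also have "\<dots> = (\<integral>v. (centred_cdf (v 1) * centred_cdf (v 1)) * (centred_cdf (v 2) * centred_cdf (v 2)) \<partial>unif_law 2)"
    by (rule Bochner_Integration.integral_cong) (auto simp: algebra_simps)
  also have "\<dots> = 1 / 9"
    by (subst integral_unif_law_pair[where A=1 and B=1])
       (simp_all only: abs_centred_cdf_mult_le integral_centred_cdf_square, simp_all)
  finally show ?thesis .
qed

text \<open>Integrating out the second observation turns the kernel into \<open>centred_cdf (x 1 1) * centred_cdf (x 1 2)\<close>
  itself, so the correlation is the second moment of this function; \<open>rho_hat_kernel\<close> behaves in the same way.\<close>

lemma tau_scale_pos: "0 < projection_scale 2 tau_kernel"
proof (rule projection_scale_pos[where B=1])
  let ?P = "sample_law 2 null_pair_law" and ?g = centred_cdf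
  have [measurable]: "(\<lambda>x. x i 1) \<in> borel_measurable (sample_law m null_pair_law)"
    "(\<lambda>x. x i 2) \<in> borel_measurable (sample_law m null_pair_law)" for i m
    by (auto intro: null_coordinate)
  show "tau_kernel \<in> borel_measurable ?P" unfolding tau_kernel_def[abs_def] by measurable
  show "\<bar>tau_kernel x\<bar> \<le> 1" for x unfolding tau_kernel_def by (rule abs_sgn_mult_le)
  have b: "\<bar>?g a * ?g b * (sgn c * sgn e)\<bar> \<le> 1" for a b c e :: real
    using mult_mono[OF abs_centred_cdf_mult_le[of a b] abs_sgn_mult_le[of c e]] by (simp only: abs_mult) simp
  have meas: "(\<lambda>x. ?g (x 1 1) * ?g (x 1 2) * (sgn (x 1 1 - x 2 1) * sgn (x 1 2 - x 2 2))) \<in> borel_measurable ?P"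
    by measurable
  have "(\<integral>x. ?g (x 1 1) * ?g (x 1 2) * tau_kernel x \<partial>?P) =
     (\<integral>x. (\<integral>v. ?g (x 1 1) * ?g (x 1 2) * (sgn (x 1 1 - v 1) * sgn (x 1 2 - v 2)) \<partial>null_pair_law) \<partial>?P)"
    unfolding tau_kernel_def by (subst null_resample[OF _ meas b, where i=2]) auto
  also have "\<dots> = (\<integral>x. ?g (x 1 1) * ?g (x 1 2) * (?g (x 1 1) * ?g (x 1 2)) \<partial>?P)"
    using integral_fgm_law_sgn_pair[of 1 2 2 0] by (simp add: fgm_law_zero null_pair_law_eq)
  also have "\<dots> = 1 / 9" by (rule null_square_moment) simp
  finally show "(\<integral>x. ?g (x 1 1) * ?g (x 1 2) * tau_kernel x \<partial>?P) \<noteq> 0" by simp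
qed simp

lemma rho_hat_scale_pos: "0 < projection_scale 3 rho_hat_kernel"
proof (rule projection_scale_pos[where B=3])
  let ?P = "sample_law 3 null_pair_law" and ?g = centred_cdf
  have [measurable]: "(\<lambda>x. x i 1) \<in> borel_measurable (sample_law m null_pair_law)"
    "(\<lambda>x. x i 2) \<in> borel_measurable (sample_law m null_pair_law)" for i m
    by (auto intro: null_coordinate)
  show "rho_hat_kernel \<in> borel_measurable ?P" unfolding rho_hat_kernel_def[abs_def] by measurable
  show "\<bar>rho_hat_kernel x\<bar> \<le> 3" for x
    using abs_sgn_mult_le[of "x 1 1 - x 2 1" "x 1 2 - x 3 2"] by (simp add: rho_hat_kernel_def abs_mult)
  have b: "\<bar>?g a * ?g b * (sgn c * sgn e)\<bar> \<le> 1" for a b c e :: real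
    using mult_mono[OF abs_centred_cdf_mult_le[of a b] abs_sgn_mult_le[of c e]] by (simp only: abs_mult) simp
  have b': "\<bar>?g a * ?g b * (sgn c * ?g e)\<bar> \<le> 1" for a b c e :: real
  proof -
    have "\<bar>sgn c * ?g e\<bar> \<le> 1" using abs_centred_cdf_le[of e] by (simp add: abs_mult abs_sgn_eq)
    then show ?thesis
      using mult_mono[OF abs_centred_cdf_mult_le[of a b], of "\<bar>sgn c * ?g e\<bar>" 1] by (simp only: abs_mult) simp
  qed
  have meas: "(\<lambda>x. ?g (x 1 1) * ?g (x 1 2) * (sgn (x 1 1 - x 2 1) * sgn (x 1 2 - x 3 2))) \<in> borel_measurable ?P"
    and meas': "(\<lambda>x. ?g (x 1 1) * ?g (x 1 2) * (sgn (x 1 1 - x 2 1) * ?g (x 1 2))) \<in> borel_measurable ?P"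
    by measurable
  have "(\<integral>x. ?g (x 1 1) * ?g (x 1 2) * rho_hat_kernel x \<partial>?P) =
     3 * (\<integral>x. ?g (x 1 1) * ?g (x 1 2) * (sgn (x 1 1 - x 2 1) * sgn (x 1 2 - x 3 2)) \<partial>?P)"
    unfolding rho_hat_kernel_def
    by (subst integral_mult_right_zero[symmetric])
       (rule Bochner_Integration.integral_cong, auto simp: algebra_simps)
  also have "(\<integral>x. ?g (x 1 1) * ?g (x 1 2) * (sgn (x 1 1 - x 2 1) * sgn (x 1 2 - x 3 2)) \<partial>?P) =
     (\<integral>x. (\<integral>v. ?g (x 1 1) * ?g (x 1 2) * (sgn (x 1 1 - x 2 1) * sgn (x 1 2 - v 2)) \<partial>null_pair_law) \<partial>?P)"
    by (subst null_resample[OF _ meas b, where i=3]) auto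
  also have "\<dots> = (\<integral>x. ?g (x 1 1) * ?g (x 1 2) * (sgn (x 1 1 - x 2 1) * ?g (x 1 2)) \<partial>?P)"
    using integral_fgm_law_sgn(2)[of 1 2 2 0] by (simp add: fgm_law_zero null_pair_law_eq)
  also have "\<dots> = (\<integral>x. (\<integral>v. ?g (x 1 1) * ?g (x 1 2) * (sgn (x 1 1 - v 1) * ?g (x 1 2)) \<partial>null_pair_law) \<partial>?P)"
    by (subst null_resample[OF _ meas' b', where i=2]) auto
  also have "\<dots> = (\<integral>x. ?g (x 1 1) * ?g (x 1 2) * (?g (x 1 1) * ?g (x 1 2)) \<partial>?P)"
    using integral_fgm_law_sgn(1)[of 1 2 2 0] by (simp add: fgm_law_zero null_pair_law_eq)
  also have "\<dots> = 1 / 9" by (rule null_square_moment) simp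
  finally show "(\<integral>x. ?g (x 1 1) * ?g (x 1 2) * rho_hat_kernel x \<partial>?P) \<noteq> 0" by simp
qed simp

lemma scale_sq_bounds: "\<exists>a b. 0 < a \<and> (\<forall>n\<ge>3. a \<le> scale_sq l n \<and> scale_sq l n \<le> b)"
proof -
  have rank: "1 / 36 \<le> real n * null_var l n \<and> real n * null_var l n \<le> 10000" if "3 \<le> n" for n
    using null_var_ge[OF that, of l] null_var_le[OF that, of l] that by (simp add: field_simps)
  show ?thesis
  proof (cases l)
    case Tau
    then show ?thesis using tau_scale_pos by auto
  next
    case Rho_hat
    then show ?thesis using rho_hat_scale_pos by auto
  next
    case Rho
    then show ?thesis using rank by (intro exI[of _ "1/36"] exI[of _ 10000]) simp
  next
    case Tau_hat
    then show ?thesis using rank by (intro exI[of _ "1/36"] exI[of _ 10000]) simp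
  qed
qed

section \<open>Power of the rank tests\<close>

lemma finite_pair_values: "finite {f j k | j k. 1 \<le> j \<and> j < k \<and> k \<le> (d::nat)}"
proof -
  have "{f j k | j k. 1 \<le> j \<and> j < k \<and> k \<le> d} \<subseteq> (\<lambda>(j, k). f j k) ` ({1..d} \<times> {1..d})" by auto
  then show ?thesis by (rule finite_subset) auto
qed

text \<open>Let \<open>r = sqrt (ln d / n)\<close>. Acceptance forces \<open>\<bar>stat\<bar> \<le> 300 r\<close> for every pair, because \<open>null_var\<close> is at
  most \<open>10000 / n\<close> and the threshold at most \<open>5 ln d\<close>; but for the pair that witnesses the alternative
  the mean is at least \<open>400 r\<close> in absolute value. Chebyshev bounds a deviation of \<open>100 r\<close> by
  \<open>10000 / (n (100 r)\<^sup>2) = 1 / ln d\<close>.\<close>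

lemma type_II_error_rank_test_le:
  assumes F: "F \<in> alternatives l n d D" and n: "3 \<le> n" and d: "3 \<le> d"
    and a: "0 < a" "a \<le> scale_sq l n" and D: "400 \<le> D * sqrt a"
    and crit: "crit_value \<alpha> - ln (ln (real d)) \<le> ln (real d)"
  shows "type_II_error n (rank_test l \<alpha> n d) F \<le> ennreal (1 / ln (real d))"
proof -
  let ?S = "sample_law n F" and ?v = "null_var l n"
  define r where "r = sqrt (ln (real d) / real n)"
  have ln0: "0 < ln (real d)" using d by simp
  then have r: "0 < r" "r\<^sup>2 = ln (real d) / real n" using n by (simp_all add: r_def)
  have v: "0 < ?v" "?v \<le> 10000 / real n"
    using null_var_ge[OF n, of l] null_var_le[OF n, of l] n
    by (auto intro: less_le_trans[of 0 "1 / (36 * real n)"])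
  let ?M = "{\<bar>dep_matrix l n F j k\<bar> | j k. 1 \<le> j \<and> j < k \<and> k \<le> d}"
  have cont: "F \<in> continuous_laws d" and Max: "D * r \<le> Max ?M"
    using F by (auto simp: alternatives_def sparse_matrices_def r_def)
  have "\<bar>dep_matrix l n F 1 2\<bar> \<in> ?M" using d by fastforce
  then have "Max ?M \<in> ?M" using finite_pair_values by (intro Max_in) auto
  then obtain j k where jk: "1 \<le> j" "j < k" "k \<le> d" and M: "Max ?M = \<bar>dep_matrix l n F j k\<bar>" by blast
  have jk': "j \<in> {1..d}" "k \<in> {1..d}" using jk by auto
  define m where "m = (\<integral>x. stat l n x j k \<partial>?S)"
  have "D * r \<le> \<bar>m\<bar> / sqrt (scale_sq l n)"
    using Max M jk a by (simp add: dep_matrix_def m_def min_def max_def)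
  then have "D * r * sqrt (scale_sq l n) \<le> \<bar>m\<bar>"
    using a by (simp add: pos_le_divide_eq)
  moreover have "400 * r \<le> D * r * sqrt (scale_sq l n)"
  proof -
    have "0 \<le> D" using D a by (smt (verit) real_sqrt_ge_zero mult_nonpos_nonneg)
    then have "D * sqrt a \<le> D * sqrt (scale_sq l n)" using a by (intro mult_left_mono) auto
    then have "400 * r \<le> D * sqrt (scale_sq l n) * r" using D r by (intro mult_right_mono) auto
    then show ?thesis by (simp add: mult_ac)
  qed
  ultimately have m: "400 * r \<le> \<bar>m\<bar>" by linarith
  let ?dev = "{x \<in> space ?S. 100 * r \<le> \<bar>stat l n x j k - m\<bar>}"
  have "{x \<in> space ?S. rank_test l \<alpha> n d x = 0} \<subseteq> ?dev"
  proof safe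
    fix x assume "rank_test l \<alpha> n d x = 0"
    let ?Q = "{(stat l n x j k)\<^sup>2 | j k. 1 \<le> j \<and> j < k \<and> k \<le> d}"
    have "(stat l n x j k)\<^sup>2 \<le> Max ?Q"
      using jk finite_pair_values by (intro Max_ge) auto
    then have "(stat l n x j k)\<^sup>2 / ?v \<le> Max ?Q / ?v" using v by (intro divide_right_mono) auto
    also have "Max ?Q / ?v < 4 * ln (real d) - ln (ln (real d)) + crit_value \<alpha>"
      using \<open>rank_test l \<alpha> n d x = 0\<close> by (simp add: rank_test_def)
    also have "\<dots> \<le> 5 * ln (real d)" using crit by simp
    finally have "(stat l n x j k)\<^sup>2 \<le> 5 * ln (real d) * ?v" using v by (simp add: field_simps)
    also have "\<dots> \<le> 5 * ln (real d) * (10000 / real n)"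
      using v ln0 by (intro mult_left_mono) auto
    also have "\<dots> \<le> (300 * r)\<^sup>2" using r ln0 n by (simp add: power_mult_distrib field_simps)
    finally have "\<bar>stat l n x j k\<bar> \<le> \<bar>300 * r\<bar>" by (simp only: abs_le_square_iff)
    then have "\<bar>stat l n x j k\<bar> \<le> 300 * r" using r by simp
    then show "100 * r \<le> \<bar>stat l n x j k - m\<bar>" using m by linarith
  qed
  then have "type_II_error n (rank_test l \<alpha> n d) F \<le> emeasure ?S ?dev"
    unfolding type_II_error_def
  proof (rule emeasure_mono)
    note [measurable] = stat_measurable[OF cont jk', of l n]
    show "?dev \<in> sets ?S" by measurable
  qed
  also have "\<dots> = ennreal (measure ?S ?dev)"
  proof -
    interpret prob_space ?S
      unfolding sample_law_def by (rule prob_space_sample) (rule continuous_lawsD(1)[OF cont])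
    show ?thesis by (rule emeasure_eq_measure)
  qed
  also have "\<dots> \<le> ennreal (1 / ln (real d))"
  proof (rule ennreal_leI)
    have "measure ?S ?dev \<le> 10000 / (real n * (100 * r)\<^sup>2)"
      unfolding m_def by (rule prob_stat_deviation_le[OF cont jk' n]) (use r in auto)
    also have "\<dots> = 1 / ln (real d)" using r n by (simp add: power_mult_distrib)
    finally show "measure ?S ?dev \<le> 1 / ln (real d)" .
  qed
  finally show ?thesis .
qed

section \<open>Indistinguishability of the mixture from independence\<close>

lemma fgm_law_alternative:
  assumes n: "3 \<le> n" and k: "k \<in> {2..d}" and \<theta>: "0 \<le> \<theta>" "\<theta> \<le> 1"
    and a: "0 < scale_sq l n" "scale_sq l n \<le> b"
    and D: "D * sqrt (ln (real d) / real n) \<le> \<theta> / (6 * sqrt b)"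
  shows "fgm_law d \<theta> 1 k \<in> alternatives l n d D"
proof -
  have jk: "1 \<in> {1..d}" "k \<in> {1..d}" "1 \<noteq> k" using k by auto
  let ?F = "fgm_law d \<theta> 1 k"
  let ?M = "{\<bar>dep_matrix l n ?F j k\<bar> | j k. 1 \<le> j \<and> j < k \<and> k \<le> d}"
  have "D * sqrt (ln (real d) / real n) \<le> (1 / 6 * \<theta>) / sqrt b" using D by simp
  also have "\<dots> \<le> (fgm_mean_coeff l n * \<theta>) / sqrt (scale_sq l n)"
    using fgm_mean_coeff_ge[OF n, of l] \<theta> a
    by (intro frac_le mult_right_mono) auto
  also have "\<dots> = dep_matrix l n ?F 1 k"
    using fgm_stat_mean[OF jk \<theta> n, of l] k by (simp add: dep_matrix_def min_def max_def)
  also have "\<dots> \<le> \<bar>dep_matrix l n ?F 1 k\<bar>" by simp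
  also have "\<dots> \<le> Max ?M"
    using k finite_pair_values by (intro Max_ge) force+
  finally show ?thesis
    using fgm_law_continuous[OF jk \<theta>]
    by (auto simp: alternatives_def sparse_matrices_def dep_matrix_def min.commute max.commute)
qed

text \<open>The chi-square distance of a uniform mixture: pairwise uncorrelated likelihood ratios with equal second moments
  behave like independent summands, so averaging divides the variance by their number.\<close>

lemma mixture_second_moment:
  fixes L :: "'k \<Rightarrow> 'a \<Rightarrow> real"
  assumes "prob_space M" and K: "finite K" "K \<noteq> {}"
    and i1: "\<And>k. k \<in> K \<Longrightarrow> integrable M (L k)"
    and i2: "\<And>k k'. k \<in> K \<Longrightarrow> k' \<in> K \<Longrightarrow> integrable M (\<lambda>x. L k x * L k' x)"
    and one: "\<And>k. k \<in> K \<Longrightarrow> (\<integral>x. L k x \<partial>M) = 1"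
    and cross: "\<And>k k'. k \<in> K \<Longrightarrow> k' \<in> K \<Longrightarrow> k \<noteq> k' \<Longrightarrow> (\<integral>x. L k x * L k' x \<partial>M) = 1"
    and square: "\<And>k. k \<in> K \<Longrightarrow> (\<integral>x. L k x * L k x \<partial>M) = q"
  shows "integrable M (\<lambda>x. ((\<Sum>k\<in>K. L k x) / card K - 1)\<^sup>2)"
    and "(\<integral>x. ((\<Sum>k\<in>K. L k x) / card K - 1)\<^sup>2 \<partial>M) = (q - 1) / card K"
proof -
  interpret prob_space M by fact
  let ?N = "real (card K)"
  have N: "?N \<noteq> 0" using K by simp
  have eq: "((\<Sum>k\<in>K. L k x) / ?N - 1)\<^sup>2 = (\<Sum>k\<in>K. \<Sum>k'\<in>K. (L k x * L k' x) / ?N\<^sup>2)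
      + (1 - (\<Sum>k\<in>K. L k x * (2 / ?N)))" for x
  proof -
    let ?S = "\<Sum>k\<in>K. L k x"
    have "(?S / ?N - 1)\<^sup>2 = ?S * ?S / ?N\<^sup>2 + (1 - ?S * (2 / ?N))"
      using N by (simp add: power2_eq_square field_simps)
    also have "?S * ?S / ?N\<^sup>2 = (\<Sum>k\<in>K. \<Sum>k'\<in>K. (L k x * L k' x) / ?N\<^sup>2)"
      by (simp only: sum_product sum_divide_distrib)
    also have "?S * (2 / ?N) = (\<Sum>k\<in>K. L k x * (2 / ?N))"
      by (rule sum_distrib_right)
    finally show ?thesis .
  qed
  show "integrable M (\<lambda>x. ((\<Sum>k\<in>K. L k x) / ?N - 1)\<^sup>2)"
    unfolding eq using i1 i2 by auto
  have "(\<integral>x. ((\<Sum>k\<in>K. L k x) / ?N - 1)\<^sup>2 \<partial>M) =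
      (\<Sum>k\<in>K. \<Sum>k'\<in>K. (\<integral>x. L k x * L k' x \<partial>M) / ?N\<^sup>2) + (1 - (\<Sum>k\<in>K. (\<integral>x. L k x \<partial>M) * (2 / ?N)))"
    unfolding eq using i1 i2 by (simp add: prob_space Bochner_Integration.integral_sum)
  also have "(\<Sum>k\<in>K. (\<integral>x. L k x \<partial>M) * (2 / ?N)) = 2"
    using one N by simp
  also have "(\<Sum>k\<in>K. \<Sum>k'\<in>K. (\<integral>x. L k x * L k' x \<partial>M) / ?N\<^sup>2) = (\<Sum>k\<in>K. (?N + (q - 1)) / ?N\<^sup>2)"
  proof (rule sum.cong[OF refl])
    fix k assume k: "k \<in> K"
    have "(\<Sum>k'\<in>K. (\<integral>x. L k x * L k' x \<partial>M) / ?N\<^sup>2) =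
        (\<Sum>k'\<in>K. (1 + (if k' = k then q - 1 else 0)) / ?N\<^sup>2)"
      using k cross square by (intro sum.cong refl) auto
    also have "\<dots> = (?N + (q - 1)) / ?N\<^sup>2"
      using k K by (simp add: sum_divide_distrib[symmetric] sum.distrib)
    finally show "(\<Sum>k'\<in>K. (\<integral>x. L k x * L k' x \<partial>M) / ?N\<^sup>2) = (?N + (q - 1)) / ?N\<^sup>2" .
  qed
  also have "\<dots> + (1 - 2) = (q - 1) / ?N" using N by (simp add: power2_eq_square field_simps)
  finally show "(\<integral>x. ((\<Sum>k\<in>K. L k x) / ?N - 1)\<^sup>2 \<partial>M) = (q - 1) / ?N" .
qed

text \<open>The acceptance probabilities of \<open>T\<close> under the null law and under the uniform mixture of the alternatives differ by
  at most the mean of \<open>\<bar>Q - 1\<bar>\<close>, where \<open>Q\<close> is the likelihood ratio of the mixture; its mean square is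
  at most \<open>\<beta>\<^sup>2\<close>. Some alternative is accepted at least as often as the mixture.\<close>

lemma type_II_error_lower_bound:
  assumes T: "T \<in> level_tests \<alpha> n d" and d: "2 \<le> d" and \<theta>: "0 \<le> \<theta>" "\<theta> \<le> 1" and \<beta>: "0 < \<beta>"
    and chi: "(1 + \<theta>\<^sup>2 / 9) ^ n - 1 \<le> \<beta>\<^sup>2 * (real d - 1)"
  shows "\<exists>k\<in>{2..d}. ennreal (1 - \<alpha> - \<beta>) \<le> type_II_error n T (fgm_law d \<theta> 1 k)"
proof -
  let ?P = "sample_law n (unif_law d)" and ?L = "likelihood_ratio n \<theta> 1" and ?K = "{2..d}"
  define A where "A = {x \<in> space ?P. T x = 0}"
  have sets: "sets ?P = sets (\<Pi>\<^sub>M i\<in>{1..n}. vec_borel d)"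
    unfolding sample_law_def by (rule sets_PiM_cong) (simp_all add: sets_unif_law)
  have Tm: "T \<in> ?P \<rightarrow>\<^sub>M count_space {0, 1}"
    using T unfolding measurable_cong_sets[OF sets refl] by (simp add: level_tests_def)
  have A[measurable]: "A \<in> sets ?P"
    using measurable_sets[OF Tm, of "{0}"] by (simp add: A_def vimage_def Int_def conj_commute)
  have level: "1 - \<alpha> \<le> measure ?P A"
  proof -
    have "measure ?P {x \<in> space ?P. T x = 1} \<le> \<alpha>"
      using T unif_law_null[of d] d by (auto simp: level_tests_def)
    moreover have "T x = 1 \<longleftrightarrow> T x \<noteq> 0" if "x \<in> space ?P" for x
      using measurable_space[OF Tm that] by auto
    then have "{x \<in> space ?P. T x = 1} = space ?P - A"
      by (auto simp: A_def)
    ultimately show ?thesis using null_sample.prob_compl[OF A] by simp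
  qed
  have jk: "1 \<in> {1..d}" "k \<in> {1..d}" "1 \<noteq> k" if "k \<in> ?K" for k using that by auto
  have Lm: "?L k \<in> borel_measurable ?P" if "k \<in> ?K" for k
    by (rule likelihood_ratio_measurable[OF jk(1,2)[OF that]])
  note Lb = likelihood_ratio_bounds[OF \<theta>, of n 1]
  have i1: "integrable ?P (?L k)" if "k \<in> ?K" for k
    by (rule integrable_null_sample[where B="2 ^ n"]) (use Lb Lm[OF that] in auto)
  have iA: "integrable ?P (\<lambda>x. ?L k x * indicator A x)" if "k \<in> ?K" for k
    using i1[OF that] A by (intro integrable_real_mult_indicator)
  have i2: "integrable ?P (\<lambda>x. ?L k x * ?L k' x)" if "k \<in> ?K" "k' \<in> ?K" for k k'
    by (rule integrable_null_sample[where B="2 ^ n * 2 ^ n"])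
       (use Lb Lm that in \<open>auto simp: abs_mult intro!: mult_mono\<close>)
  let ?N = "real (card ?K)"
  define Q where "Q = (\<lambda>x. (\<Sum>k\<in>?K. ?L k x) / ?N)"
  have N: "?N = real d - 1" "0 < ?N" using d by (auto simp: of_nat_diff)
  have one: "(\<integral>x. ?L k x \<partial>?P) = 1" if "k \<in> ?K" for k
    by (rule integral_likelihood_ratio[OF jk[OF that] \<theta>])
  have cross: "(\<integral>x. ?L k x * ?L k' x \<partial>?P) = 1" if "k \<in> ?K" "k' \<in> ?K" "k \<noteq> k'" for k k'
    by (rule likelihood_ratio_cross_moment[OF jk(1,2)[OF that(1)] jk(2)[OF that(2)] jk(3)[OF that(1)] jk(3)[OF that(2)] that(3) \<theta>])
  have square: "(\<integral>x. ?L k x * ?L k x \<partial>?P) = (1 + \<theta>\<^sup>2 / 9) ^ n" if "k \<in> ?K" for k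
    by (rule likelihood_ratio_second_moment[OF jk[OF that] \<theta>])
  have "?K \<noteq> {}" using d by simp
  note mix = mixture_second_moment[where L="?L", OF null_sample.prob_space_axioms finite_atLeastAtMost this
      i1 i2 one cross square]
  have chi2: "integrable ?P (\<lambda>x. (Q x - 1)\<^sup>2)" "(\<integral>x. (Q x - 1)\<^sup>2 \<partial>?P) = ((1 + \<theta>\<^sup>2 / 9) ^ n - 1) / ?N"
    unfolding Q_def using mix by simp_all
  have QA: "Q x * indicator A x = (\<Sum>k\<in>?K. ?L k x * indicator A x / ?N)" for x
    by (simp only: Q_def sum_distrib_right sum_divide_distrib times_divide_eq_left)
  have iQ: "integrable ?P (\<lambda>x. Q x * indicator A x)"
    unfolding QA by (intro Bochner_Integration.integrable_sum Bochner_Integration.integrable_divide iA)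
  have err: "measure (sample_law n (fgm_law d \<theta> 1 k)) A = (\<integral>x. ?L k x * indicator A x \<partial>?P)"
    if "k \<in> ?K" for k
  proof -
    have "A \<in> sets (sample_law n (fgm_law d \<theta> 1 k))"
      unfolding fgm_sample_law_density[OF jk[OF that] \<theta>] using A by simp
    then have "measure (sample_law n (fgm_law d \<theta> 1 k)) A = (\<integral>x. indicator A x \<partial>sample_law n (fgm_law d \<theta> 1 k))"
      by (simp add: sets.Int_space_eq2)
    then show ?thesis using integral_fgm_sample_law[OF jk[OF that] \<theta>, of "indicator A" n] A by simp
  qed
  have "measure ?P A - (\<Sum>k\<in>?K. measure (sample_law n (fgm_law d \<theta> 1 k)) A) / ?N
      = (\<integral>x. indicator A x - Q x * indicator A x \<partial>?P)"
  proof -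
    have "(\<Sum>k\<in>?K. measure (sample_law n (fgm_law d \<theta> 1 k)) A) / ?N = (\<integral>x. Q x * indicator A x \<partial>?P)"
      unfolding QA sum_divide_distrib
      by (subst Bochner_Integration.integral_sum)
         (auto intro!: sum.cong Bochner_Integration.integrable_divide iA simp: err simp del: One_nat_def)
    moreover have "measure ?P A = (\<integral>x. indicator A x \<partial>?P)"
      using A by (simp add: sets.Int_space_eq2)
    moreover have "integrable ?P (indicator A :: _ \<Rightarrow> real)"
      using A by (intro integrable_real_indicator) (auto simp: null_sample.emeasure_finite less_top[symmetric])
    ultimately show ?thesis using iQ by (simp only: Bochner_Integration.integral_diff)
  qed
  also have "\<dots> \<le> (\<integral>x. \<beta> / 2 + (Q x - 1)\<^sup>2 / (2 * \<beta>) \<partial>?P)"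
  proof (rule integral_mono)
    show "integrable ?P (\<lambda>x. indicator A x - Q x * indicator A x)"
      using iQ A by (intro Bochner_Integration.integrable_diff) (auto simp: null_sample.emeasure_finite less_top[symmetric])
    show "integrable ?P (\<lambda>x. \<beta> / 2 + (Q x - 1)\<^sup>2 / (2 * \<beta>))" using chi2(1) by auto
    fix x
    \<comment> \<open>The arithmetic-geometric mean inequality, weighted so that both terms integrate to at most \<open>\<beta> / 2\<close>.\<close>
    have "1 - Q x \<le> \<beta> / 2 + (Q x - 1)\<^sup>2 / (2 * \<beta>)"
    proof -
      have "0 \<le> (\<beta> - (1 - Q x))\<^sup>2 / (2 * \<beta>)" using \<beta> by simp
      then show ?thesis using \<beta> by (simp add: power2_eq_square field_simps)
    qed
    moreover have "0 \<le> \<beta> / 2 + (Q x - 1)\<^sup>2 / (2 * \<beta>)" using \<beta> by simp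
    ultimately show "indicator A x - Q x * indicator A x \<le> \<beta> / 2 + (Q x - 1)\<^sup>2 / (2 * \<beta>)"
      by (auto split: split_indicator)
  qed
  also have "\<dots> = \<beta> / 2 + ((1 + \<theta>\<^sup>2 / 9) ^ n - 1) / ?N / (2 * \<beta>)"
    using chi2 by (simp add: null_sample.prob_space)
  also have "\<dots> \<le> \<beta> / 2 + \<beta>\<^sup>2 / (2 * \<beta>)"
    using chi N \<beta> by (intro add_left_mono divide_right_mono) (auto simp: pos_divide_le_eq)
  also have "\<dots> = \<beta>" using \<beta> by (simp add: power2_eq_square)
  finally have "1 - \<alpha> - \<beta> \<le> (\<Sum>k\<in>?K. measure (sample_law n (fgm_law d \<theta> 1 k)) A) / ?N"
    using level by linarith
  then have avg: "(1 - \<alpha> - \<beta>) * ?N \<le> (\<Sum>k\<in>?K. measure (sample_law n (fgm_law d \<theta> 1 k)) A)"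
    using N(2) by (simp only: pos_le_divide_eq)
  have "\<exists>k\<in>?K. 1 - \<alpha> - \<beta> \<le> measure (sample_law n (fgm_law d \<theta> 1 k)) A"
  proof (rule ccontr)
    assume "\<not> ?thesis"
    then have "(\<Sum>k\<in>?K. measure (sample_law n (fgm_law d \<theta> 1 k)) A) < (\<Sum>k\<in>?K. 1 - \<alpha> - \<beta>)"
      using d by (intro sum_strict_mono) (auto simp: not_le)
    then show False using avg by (simp add: mult.commute)
  qed
  then obtain k where k: "k \<in> ?K" and le: "1 - \<alpha> - \<beta> \<le> measure (sample_law n (fgm_law d \<theta> 1 k)) A" ..
  interpret S: prob_space "sample_law n (fgm_law d \<theta> 1 k)"
    unfolding sample_law_def by (rule prob_space_sample) (rule prob_space_fgm_law[OF jk[OF k] \<theta>])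
  have "space (sample_law n (fgm_law d \<theta> 1 k)) = space ?P"
    unfolding fgm_sample_law_density[OF jk[OF k] \<theta>] by simp
  then have "type_II_error n T (fgm_law d \<theta> 1 k) = ennreal (measure (sample_law n (fgm_law d \<theta> 1 k)) A)"
    using S.emeasure_eq_measure[of A] by (simp add: type_II_error_def A_def)
  then show ?thesis using le k by (auto intro!: bexI[of _ k] ennreal_leI)
qed

section \<open>Rate optimality\<close>

theorem corollary3:
  fixes \<alpha> :: real and d :: "nat \<Rightarrow> nat"
  assumes "0 < \<alpha>" and "\<alpha> < 1"
    and "filterlim d at_top sequentially"
    and "(\<lambda>n. ln (real (d n))) \<in> o(\<lambda>n. real n powr (1 / 3))"
  shows "\<forall>l :: stat_type. \<exists>D1 D2 :: real. 0 < D1 \<and> D1 < D2 \<and>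
    ((\<lambda>n. SUP F\<in>alternatives l n (d n) D2. type_II_error n (rank_test l \<alpha> n (d n)) F)
       \<longlonglongrightarrow> 0) \<and>
    (\<forall>\<beta>>0. \<alpha> + \<beta> < 1 \<longrightarrow>
       (\<forall>\<^sub>F n in sequentially.
          (INF T\<in>level_tests \<alpha> n (d n).
             SUP F\<in>alternatives l n (d n) D1. type_II_error n T F) \<ge> ennreal (1 - \<alpha> - \<beta>)))"
proof
  fix l
  obtain a b where ab: "0 < a" "\<And>n. 3 \<le> n \<Longrightarrow> a \<le> scale_sq l n" "\<And>n. 3 \<le> n \<Longrightarrow> scale_sq l n \<le> b"
    using scale_sq_bounds[of l] by blast
  have b: "0 < b" using ab(1) ab(2)[of 3] ab(3)[of 3] by linarith
  \<comment> \<open>\<open>D1\<close> is what the mean \<open>\<theta> / 6\<close> with \<open>\<theta> = sqrt (ln d / n) / 2\<close> guarantees after division by a scale of at most \<open>sqrt b\<close>.\<close>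
  define D1 where "D1 = 1 / (12 * sqrt b)"
  define D2 where "D2 = D1 + 400 / sqrt a"
  have D: "0 < D1" "D1 < D2" "400 \<le> D2 * sqrt a"
    using ab(1) b by (auto simp: D1_def D2_def distrib_right)
  have n3: "\<forall>\<^sub>F n in sequentially. 3 \<le> n" by (rule eventually_ge_at_top)
  have d3: "\<forall>\<^sub>F n in sequentially. 3 \<le> d n"
    using assms(3) by (simp add: filterlim_at_top)
  have dreal: "filterlim (\<lambda>n. real (d n)) at_top sequentially"
    by (rule filterlim_compose[OF filterlim_real_sequentially assms(3)])
  have dln: "filterlim (\<lambda>n. ln (real (d n))) at_top sequentially"
    by (rule filterlim_compose[OF ln_at_top dreal])
  \<comment> \<open>The growth condition ensures that \<open>\<theta>\<close> is an admissible copula parameter.\<close>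
  have rate: "\<forall>\<^sub>F n in sequentially. ln (real (d n)) \<le> real n"
    using landau_o.smallD[OF assms(4) zero_less_one] n3
  proof eventually_elim
    case (elim n)
    then have "ln (real (d n)) \<le> real n powr (1 / 3)" by simp
    also have "\<dots> \<le> real n powr 1" using elim by (intro powr_mono) auto
    finally show ?case using elim by simp
  qed
  have "(\<lambda>n. SUP F\<in>alternatives l n (d n) D2. type_II_error n (rank_test l \<alpha> n (d n)) F) \<longlonglongrightarrow> 0"
  proof (rule tendsto_sandwich)
    show "\<forall>\<^sub>F n in sequentially. 0 \<le>
        (SUP F\<in>alternatives l n (d n) D2. type_II_error n (rank_test l \<alpha> n (d n)) F)" by simp
    have "\<forall>\<^sub>F n in sequentially. max 1 (crit_value \<alpha>) \<le> ln (real (d n))"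
      using dln unfolding filterlim_at_top by blast
    then show "\<forall>\<^sub>F n in sequentially.
        (SUP F\<in>alternatives l n (d n) D2. type_II_error n (rank_test l \<alpha> n (d n)) F)
          \<le> ennreal (1 / ln (real (d n)))"
      using n3 d3
    proof eventually_elim
      case (elim n)
      have "0 \<le> ln (ln (real (d n)))" using elim by (intro ln_ge_zero) auto
      moreover have "crit_value \<alpha> \<le> ln (real (d n))" using elim by simp
      ultimately have "crit_value \<alpha> - ln (ln (real (d n))) \<le> ln (real (d n))" by linarith
      then show ?case
        using elim ab D by (intro SUP_least type_II_error_rank_test_le[where a=a]) auto
    qed
    have "((\<lambda>n. 1 / ln (real (d n))) \<longlongrightarrow> 0) sequentially"
      by (rule tendsto_divide_0[OF tendsto_const]) (rule filterlim_at_top_imp_at_infinity[OF dln])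
    then show "(\<lambda>n. ennreal (1 / ln (real (d n)))) \<longlonglongrightarrow> 0"
      using tendsto_ennrealI by force
  qed simp
  moreover have "\<forall>\<^sub>F n in sequentially. ennreal (1 - \<alpha> - \<beta>) \<le>
      (INF T\<in>level_tests \<alpha> n (d n). SUP F\<in>alternatives l n (d n) D1. type_II_error n T F)"
    if \<beta>: "0 < \<beta>" for \<beta>
  proof -
    have "filterlim (\<lambda>n. sqrt (real (d n))) at_top sequentially"
      by (rule filterlim_compose[OF sqrt_at_top dreal])
    then have "\<forall>\<^sub>F n in sequentially. 1 / \<beta>\<^sup>2 \<le> sqrt (real (d n))"
      unfolding filterlim_at_top by blast
    then show ?thesis
      using n3 d3 rate
    proof eventually_elim
      case (elim n)
      let ?d = "real (d n)"
      define \<theta> where "\<theta> = sqrt (ln ?d / real n) / 2"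
      have ln0: "0 < ln ?d" using elim by simp
      have "sqrt (ln ?d / real n) \<le> 1" "0 \<le> sqrt (ln ?d / real n)" using elim ln0 by simp_all
      then have \<theta>: "0 \<le> \<theta>" "\<theta> \<le> 1" unfolding \<theta>_def by linarith+
      have \<theta>2: "\<theta>\<^sup>2 = ln ?d / (4 * real n)" using ln0 by (simp add: \<theta>_def power_divide)
      have "(1 + \<theta>\<^sup>2 / 9) ^ n \<le> exp (\<theta>\<^sup>2 / 9) ^ n"
        using \<theta> by (intro power_mono exp_ge_add_one_self) auto
      also have "\<dots> = exp (ln ?d / 36)"
        using elim by (simp add: exp_of_nat_mult[symmetric] \<theta>2)
      also have "\<dots> \<le> exp (ln ?d / 2)" using ln0 by simp
      also have "\<dots> = sqrt ?d"
        using elim by (simp add: ln_sqrt[symmetric])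
      finally have "(1 + \<theta>\<^sup>2 / 9) ^ n - 1 \<le> sqrt ?d - 1" by simp
      also have "\<dots> = 1 * (sqrt ?d - 1)" by simp
      also have "\<dots> \<le> (\<beta>\<^sup>2 * (sqrt ?d + 1)) * (sqrt ?d - 1)"
      proof (rule mult_right_mono)
        have "1 \<le> \<beta>\<^sup>2 * sqrt ?d" using elim \<beta> by (simp add: field_simps)
        then show "1 \<le> \<beta>\<^sup>2 * (sqrt ?d + 1)" by (simp add: distrib_left add_increasing2)
      qed (use elim in auto)
      also have "\<dots> = \<beta>\<^sup>2 * (?d - 1)"
        by (simp add: algebra_simps)
      finally have chi: "(1 + \<theta>\<^sup>2 / 9) ^ n - 1 \<le> \<beta>\<^sup>2 * (?d - 1)" .
      show ?case
      proof (rule INF_greatest)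
        fix T assume T: "T \<in> level_tests \<alpha> n (d n)"
        obtain k where k: "k \<in> {2..d n}" "ennreal (1 - \<alpha> - \<beta>) \<le> type_II_error n T (fgm_law (d n) \<theta> 1 k)"
          using type_II_error_lower_bound[OF T _ \<theta> \<beta> chi] elim by auto
        have "fgm_law (d n) \<theta> 1 k \<in> alternatives l n (d n) D1"
          using elim ab(1) ab(2)[of n] ab(3)[of n] b k \<theta>
          by (intro fgm_law_alternative[where b=b]) (auto simp: D1_def \<theta>_def)
        then show "ennreal (1 - \<alpha> - \<beta>) \<le> (SUP F\<in>alternatives l n (d n) D1. type_II_error n T F)"
          using k(2) by (rule SUP_upper2)
      qed
    qed
  qed
  ultimately show "\<exists>D1 D2. 0 < D1 \<and> D1 < D2 \<and>
    ((\<lambda>n. SUP F\<in>alternatives l n (d n) D2. type_II_error n (rank_test l \<alpha> n (d n)) F) \<longlonglongrightarrow> 0) \<and>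
    (\<forall>\<beta>>0. \<alpha> + \<beta> < 1 \<longrightarrow> (\<forall>\<^sub>F n in sequentially.
       ennreal (1 - \<alpha> - \<beta>) \<le> (INF T\<in>level_tests \<alpha> n (d n).
          SUP F\<in>alternatives l n (d n) D1. type_II_error n T F)))"
    using D by blast
qed

end
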